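(* Let $\mu$ be a Borel probability measure on $\mathbb{R}^n$ whose support is contained in a ball of radius $R$. For $\delta>0$ let $\gamma_\delta$ be the centered Gaussian measure on $\mathbb{R}^n$ with density $(2\pi\delta)^{-n/2}\exp\left(\frac{-|x|^2}{2\delta}\right)$. Then for all $\delta>2R^2n$, the convolution $\mu*\gamma_\delta$ satisfies a logarithmic Sobolev inequality, i.e. it satisfies a logarithmic Sobolev inequality with constant $c$ for some $c\in\mathbb{R}$.
   Context: A probability measure $\nu$ on $\mathbb{R}^n$ satisfies a logarithmic Sobolev inequality (LSI) with constant $c\in\mathbb{R}$ if $\mathrm{Ent}_\nu(g^2)\leq 2c\int|\nabla g|^2\,d\nu$ for all smooth and sufficiently integrable functions $g:\mathbb{R}^n\to\mathbb{R}$ (meaning: $g$ is $C^\infty$ and $g^2$, $g^2\log g^2$ and $|\nabla g|^2$ are $\nu$-integrable), where for measurable $f\geq 0$, $\mathrm{Ent}_\nu(f)=\int f\log f\,d\nu-\int f\,d\nu\,\log\int f\,d\nu$, with the convention $0\log 0=0$. The ball may be centered at any point of $\mathbb{R}^n$; $|\cdot|$ is the Euclidean norm. *)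

theory Defs
  imports "HOL-Probability.Probability"
begin

text \<open>The topological support: all points each of whose open neighbourhoods has positive mass.\<close>

definition measure_support :: "'a::topological_space measure \<Rightarrow> 'a set" where
  "measure_support M = {x. \<forall>U. open U \<and> x \<in> U \<longrightarrow> 0 < emeasure M U}"

definition gaussian_measure :: "real \<Rightarrow> (real ^ 'n) measure" where
  "gaussian_measure \<delta> =
     density lborel (\<lambda>x. ennreal ((2 * pi * \<delta>) powr (- (real CARD('n) / 2)) *
                                  exp (- (norm x)\<^sup>2 / (2 * \<delta>))))"

text \<open>\<open>Ck k f\<close>: \<open>f\<close> is \<open>k\<close> times continuously differentiable on the whole space, expressed by
  recursion on the directional derivatives of \<open>f\<close>.\<close>

primrec Ck :: "nat \<Rightarrow> ('a::real_normed_vector \<Rightarrow> 'b::real_normed_vector) \<Rightarrow> bool" where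
  "Ck 0 f \<longleftrightarrow> continuous_on UNIV f"
| "Ck (Suc k) f \<longleftrightarrow> (\<forall>x. f differentiable (at x)) \<and>
                  (\<forall>v. Ck k (\<lambda>x. frechet_derivative f (at x) v))"

definition smooth :: "('a::real_normed_vector \<Rightarrow> 'b::real_normed_vector) \<Rightarrow> bool" where
  "smooth f \<longleftrightarrow> (\<forall>k. Ck k f)"

definition gradient :: "('a::real_inner \<Rightarrow> real) \<Rightarrow> 'a \<Rightarrow> 'a" where
  "gradient f x = (THE D. GDERIV f x :> D)"

lemma gradient_eqI:
  assumes "GDERIV f x :> D"
  shows "gradient f x = D"
  unfolding gradient_def
proof (rule the_equality)
  fix D' assume "GDERIV f x :> D'"
  with assms have "(\<lambda>h. inner h D') = (\<lambda>h. inner h D)"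
    unfolding gderiv_def by (rule has_derivative_unique[rotated])
  then have "inner (D' - D) D' = inner (D' - D) D"
    by (rule fun_cong)
  then have "inner (D' - D) (D' - D) = 0"
    by (simp add: inner_diff_right)
  then show "D' = D"
    by simp
qed (fact assms)

text \<open>Since \<open>ln 0 = 0\<close>, the convention \<open>0 log 0 = 0\<close> holds in both terms.\<close>

definition Ent :: "'a measure \<Rightarrow> ('a \<Rightarrow> real) \<Rightarrow> real" where
  "Ent M f = (\<integral>x. f x * ln (f x) \<partial>M) - (\<integral>x. f x \<partial>M) * ln (\<integral>x. f x \<partial>M)"

definition log_sobolev :: "'a::euclidean_space measure \<Rightarrow> real \<Rightarrow> bool" where
  "log_sobolev \<nu> c \<longleftrightarrow>
     (\<forall>g :: 'a \<Rightarrow> real.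
        smooth g \<longrightarrow>
        integrable \<nu> (\<lambda>x. (g x)\<^sup>2) \<longrightarrow>
        integrable \<nu> (\<lambda>x. (g x)\<^sup>2 * ln ((g x)\<^sup>2)) \<longrightarrow>
        integrable \<nu> (\<lambda>x. (norm (gradient g x))\<^sup>2) \<longrightarrow>
        Ent \<nu> (\<lambda>x. (g x)\<^sup>2) \<le> 2 * c * (\<integral>x. (norm (gradient g x))\<^sup>2 \<partial>\<nu>))"

end

theory Submission
  imports Defs
begin

text \<open>The density of \<open>\<mu> * \<gamma>\<^sub>\<delta>\<close> is the Gaussian mixture \<open>p z = \<integral> K exp (- |z - \<xi>|\<^sup>2 / (2 \<delta>)) d\<mu>(\<xi>)\<close>. Formally,
the Hessian of \<open>- ln p\<close> is \<open>1 / \<delta>\<close> minus a covariance matrix divided by \<open>\<delta>\<^sup>2\<close>, and since \<open>\<mu>\<close> lives on a ball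
of radius \<open>R\<close> the covariance is at most \<open>R\<^sup>2\<close>. So \<open>p\<close> is strongly log-concave with constant
\<open>c = 1 / \<delta> - R\<^sup>2 / \<delta>\<^sup>2\<close>, which is positive as soon as \<open>\<delta> > R\<^sup>2\<close>, and in particular when \<open>\<delta> > 2 R\<^sup>2 n\<close>. A strongly
log-concave probability density satisfies a logarithmic Sobolev inequality, and this gives the
theorem.

The first step is \<open>strongly_log_concave_gaussian_mixture\<close>; it proves the finite-difference form of
the Hessian bound with Hoeffding's lemma for the tilted measures, so that \<open>p\<close> is never
differentiated.

The second step avoids the Bakry--Emery semigroup calculus. Following Bobkov and Ledoux, it
derives the inequality from the Prekopa--Leindler inequality (\<open>prekopa_leindler\<close>), which in turn
rests on the Brunn--Minkowski inequality on the line and an induction over the coordinates.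
Applied to \<open>\<phi>\<^sup>1\<^sup>/\<^sup>t p\<close> and \<open>p\<close>, with \<open>t\<close> tending to 1, Prekopa--Leindler becomes an inequality between
derivatives at \<open>t = 1\<close>, and the derivative of the power mean of \<open>\<phi>\<close> produces the entropy of \<open>\<phi>\<close>. This is
\<open>entropy_le_energy_of_semiconcave\<close>, for bounded \<open>\<phi>\<close> that are bounded away from zero and have
second-order bounds; a general smooth \<open>g\<close> is reached by applying it to \<open>(g \<eta>)\<^sup>2 + \<epsilon>\<close> with cutoff functions
\<open>\<eta>\<close> and passing to the limit (\<open>log_sobolev_of_strongly_log_concave\<close>).\<close>

section \<open>The Prekopa--Leindler inequality\<close>

text \<open>The relation \<open>p\<^sup>t q\<^sup>1\<^sup>-\<^sup>t \<le> r\<close> on extended nonnegative numbers, tested on real lower bounds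
of \<open>p\<close> and \<open>q\<close>. Real powers of infinite values never occur in this form, and it is
preserved when a variable is integrated out, so the induction over the dimension needs no
integrability hypotheses on the sections.\<close>

definition geometric_mean_le :: "real \<Rightarrow> ennreal \<Rightarrow> ennreal \<Rightarrow> ennreal \<Rightarrow> bool" where
  "geometric_mean_le t p q r \<longleftrightarrow>
     (\<forall>a b. 0 \<le> a \<longrightarrow> 0 \<le> b \<longrightarrow> ennreal a \<le> p \<longrightarrow> ennreal b \<le> q \<longrightarrow>
        ennreal (a powr t * b powr (1 - t)) \<le> r)"

lemma geometric_mean_le_ennreal:
  assumes "0 < t" "t < 1" "0 \<le> a" "0 \<le> b" "a powr t * b powr (1 - t) \<le> c"
  shows "geometric_mean_le t (ennreal a) (ennreal b) (ennreal c)"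
  unfolding geometric_mean_le_def
proof (intro allI impI)
  fix a' b' :: real
  assume "0 \<le> a'" "0 \<le> b'" "ennreal a' \<le> ennreal a" "ennreal b' \<le> ennreal b"
  then have "a' powr t * b' powr (1 - t) \<le> a powr t * b powr (1 - t)"
    using assms by (intro mult_mono powr_mono2) (auto simp: ennreal_le_iff)
  then show "ennreal (a' powr t * b' powr (1 - t)) \<le> ennreal c"
    using assms by (intro ennreal_leI) linarith
qed

lemma lborel_compact_approx:
  fixes A :: "real set"
  assumes A: "A \<in> sets borel" and a: "a < emeasure lborel A"
  obtains K where "compact K" "K \<subseteq> A" "a < emeasure lborel K"
proof -
  define D where "D n = {- real n..real n}" for n
  have UD: "(\<Union>n. D n) = UNIV"
  proof -
    have "x \<in> D (nat \<lceil>\<bar>x\<bar>\<rceil>)" for x unfolding D_def atLeastAtMost_iff by linarith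
    then show ?thesis by blast
  qed
  have "(SUP n. emeasure lborel (A \<inter> D n)) = emeasure lborel (\<Union>n. A \<inter> D n)"
    using A by (intro SUP_emeasure_incseq) (auto simp: D_def incseq_def)
  also have "(\<Union>n. A \<inter> D n) = A" using UD by blast
  finally obtain n where n: "a < emeasure lborel (A \<inter> D n)"
    using a by (metis less_SUP_iff)
  define M where "M = density lborel (indicator (D n) :: real \<Rightarrow> ennreal)"
  have M: "emeasure M B = emeasure lborel (B \<inter> D n)" if "B \<in> sets borel" for B
  proof -
    have "emeasure M B = (\<integral>\<^sup>+x. indicator (B \<inter> D n) x \<partial>lborel)"
      unfolding M_def using that
      by (subst emeasure_density) (auto simp: indicator_inter_arith mult.commute D_def intro!: nn_integral_cong simp del: nn_integral_indicator)
    then show ?thesis using that by (simp add: D_def)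
  qed
  have "emeasure M (space M) \<noteq> \<infinity>"
    using M[of UNIV] by (simp add: M_def D_def)
  then have "emeasure M A = (SUP K\<in>{K. K \<subseteq> A \<and> compact K}. emeasure M K)"
    using A by (intro inner_regular) (auto simp: M_def)
  then obtain K where K: "K \<subseteq> A" "compact K" "a < emeasure M K"
    using n M[OF A] by (auto simp: less_SUP_iff)
  have "emeasure M K \<le> emeasure lborel K"
    using K by (subst M) (auto intro!: emeasure_mono simp: borel_compact)
  then show thesis using K that by (meson less_le_trans)
qed

lemma emeasure_lborel_affine_compact:
  fixes K :: "real set"
  assumes "compact K" "0 \<le> t"
  shows "emeasure lborel ((\<lambda>x. t * x + d) ` K) = ennreal t * emeasure lborel K"
proof -
  have "compact ((\<lambda>x. t * x + d) ` K)"
    by (intro compact_continuous_image continuous_intros assms)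
  then have b: "(\<lambda>x. t * x + d) ` K \<in> sets lborel" "K \<in> sets lborel"
    using assms by (auto simp: borel_compact)
  show ?thesis
    using emeasure_lebesgue_affine[of t d K] b assms(2)
    by (simp add: add.commute)
qed

text \<open>The set \<open>t K + (1 - t) L\<close> contains a translate of \<open>t K\<close>, obtained by fixing the least point of \<open>L\<close>,
and a translate of \<open>(1 - t) L\<close>, obtained by fixing the greatest point of \<open>K\<close>. The first lies to the
left of the second and they meet in the single point \<open>c\<close>, so their lengths add up.\<close>

lemma brunn_minkowski_compact:
  fixes K L G :: "real set"
  assumes KL: "compact K" "compact L" "K \<noteq> {}" "L \<noteq> {}" and G: "G \<in> sets borel"
    and t: "0 \<le> t" "t \<le> 1"
    and sub: "\<And>x y. x \<in> K \<Longrightarrow> y \<in> L \<Longrightarrow> t * x + (1 - t) * y \<in> G"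
  shows "ennreal t * emeasure lborel K + ennreal (1 - t) * emeasure lborel L \<le> emeasure lborel G"
proof -
  obtain k where k: "k \<in> K" "\<And>x. x \<in> K \<Longrightarrow> x \<le> k"
    using compact_attains_sup[OF KL(1,3)] by blast
  obtain l where l: "l \<in> L" "\<And>y. y \<in> L \<Longrightarrow> l \<le> y"
    using compact_attains_inf[OF KL(2,4)] by blast
  define A where "A = (\<lambda>x. t * x + (1 - t) * l) ` K"
  define B where "B = (\<lambda>y. (1 - t) * y + t * k) ` L"
  define c where "c = t * k + (1 - t) * l"
  have "compact A" "compact B" unfolding A_def B_def
    by (intro compact_continuous_image continuous_intros KL)+
  then have m: "A \<in> sets lborel" "B \<in> sets lborel" by (auto simp: borel_compact)
  have Ac: "x \<le> c" if "x \<in> A" for x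
    using that k t by (auto simp: A_def c_def intro!: mult_left_mono)
  have Bc: "c \<le> x" if "x \<in> B" for x
    using that l t by (auto simp: B_def c_def intro!: mult_left_mono)
  have "emeasure lborel (A - {c}) = emeasure lborel A"
    using m by (intro emeasure_Diff_null_set) auto
  moreover have "emeasure lborel (A - {c}) + emeasure lborel B = emeasure lborel ((A - {c}) \<union> B)"
    using m Ac Bc by (intro plus_emeasure) (auto, metis dual_order.antisym)
  moreover have "emeasure lborel ((A - {c}) \<union> B) \<le> emeasure lborel G"
    using G m sub k l by (intro emeasure_mono) (auto simp: A_def B_def add.commute)
  moreover have "emeasure lborel A = ennreal t * emeasure lborel K"
    "emeasure lborel B = ennreal (1 - t) * emeasure lborel L"
    unfolding A_def B_def using KL t by (auto intro: emeasure_lborel_affine_compact)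
  ultimately show ?thesis by simp
qed

text \<open>By inner regularity the lengths of \<open>E\<close> and \<open>F\<close> are suprema over nonempty compact subsets. Working
below \<open>G\<close> avoids the question of whether \<open>t E + (1 - t) F\<close> is measurable.\<close>

lemma brunn_minkowski_real:
  fixes E F G :: "real set"
  assumes ne: "E \<noteq> {}" "F \<noteq> {}"
    and m: "E \<in> sets borel" "F \<in> sets borel" "G \<in> sets borel"
    and t: "0 < t" "t < 1"
    and sub: "\<And>x y. x \<in> E \<Longrightarrow> y \<in> F \<Longrightarrow> t * x + (1 - t) * y \<in> G"
  shows "ennreal t * emeasure lborel E + ennreal (1 - t) * emeasure lborel F \<le> emeasure lborel G"
proof -
  have reg: "emeasure lborel X = (SUP K\<in>{K. K \<subseteq> X \<and> K \<noteq> {} \<and> compact K}. emeasure lborel K)"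
    if X: "X \<in> sets borel" "X \<noteq> {}" for X :: "real set"
  proof (rule antisym)
    show "emeasure lborel X \<le> (SUP K\<in>{K. K \<subseteq> X \<and> K \<noteq> {} \<and> compact K}. emeasure lborel K)"
    proof (rule dense_le)
      fix a assume "a < emeasure lborel X"
      then obtain K where K: "compact K" "K \<subseteq> X" "a < emeasure lborel K"
        using lborel_compact_approx X by metis
      then have "K \<noteq> {}" by auto
      with K(1,2) have "emeasure lborel K \<le> (SUP K\<in>{K. K \<subseteq> X \<and> K \<noteq> {} \<and> compact K}. emeasure lborel K)"
        by (intro SUP_upper) simp
      with K show "a \<le> (SUP K\<in>{K. K \<subseteq> X \<and> K \<noteq> {} \<and> compact K}. emeasure lborel K)"
        by (meson less_imp_le order.trans)
    qed
    show "(SUP K\<in>{K. K \<subseteq> X \<and> K \<noteq> {} \<and> compact K}. emeasure lborel K) \<le> emeasure lborel X"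
      using X by (intro SUP_least emeasure_mono) auto
  qed
  have ne': "{K. K \<subseteq> X \<and> K \<noteq> {} \<and> compact K} \<noteq> {}" if "X \<noteq> {}" for X :: "real set"
    using that by (auto intro!: exI[of _ "{SOME x. x \<in> X}"] simp: some_in_eq)
  show ?thesis
    unfolding reg[OF m(1) ne(1)] reg[OF m(2) ne(2)] SUP_mult_left_ennreal
      ennreal_SUP_add_left[OF ne'[OF ne(1)], symmetric]
    unfolding ennreal_SUP_add_right[OF ne'[OF ne(2)]]
    using m t sub by (intro SUP_least brunn_minkowski_compact) auto
qed

lemma nn_integral_layer_cake_unit:
  fixes f :: "real \<Rightarrow> real"
  assumes [measurable]: "f \<in> borel_measurable borel" and f: "\<And>x. 0 \<le> f x" "\<And>x. f x \<le> 1"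
  shows "(\<integral>\<^sup>+x. ennreal (f x) \<partial>lborel) =
    (\<integral>\<^sup>+l. emeasure lborel {x. l < f x} * indicator {0<..<1} l \<partial>lborel)"
proof -
  have "(\<integral>\<^sup>+x. ennreal (f x) \<partial>lborel) =
    (\<integral>\<^sup>+x. (\<integral>\<^sup>+l. indicator {0<..<1} l * indicator {l. l < f x} l \<partial>lborel) \<partial>lborel)"
  proof (intro nn_integral_cong)
    fix x
    have "(\<integral>\<^sup>+l. indicator {0<..<1} l * indicator {l. l < f x} l \<partial>lborel)
        = (\<integral>\<^sup>+l. indicator {0<..<f x} l \<partial>lborel)"
      using f(2)[of x] by (intro nn_integral_cong) (auto split: split_indicator)
    then show "ennreal (f x) = (\<integral>\<^sup>+l. indicator {0<..<1} l * indicator {l. l < f x} l \<partial>lborel)"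
      using f(1)[of x] by simp
  qed
  also have "\<dots> = (\<integral>\<^sup>+l. (\<integral>\<^sup>+x. indicator {0<..<1} l * indicator {x. l < f x} x \<partial>lborel) \<partial>lborel)"
    by (subst lborel_pair.Fubini') (auto simp: indicator_def intro!: nn_integral_cong)
  also have "\<dots> = (\<integral>\<^sup>+l. emeasure lborel {x. l < f x} * indicator {0<..<1} l \<partial>lborel)"
    by (intro nn_integral_cong, subst nn_integral_cmult) (auto simp: mult.commute)
  finally show ?thesis .
qed

text \<open>When both functions have supremum 1, every level set at a height below 1 is nonempty, so
Brunn--Minkowski applies at each height and the layer cake formula adds up the results. The
conclusion is then the arithmetic mean of the two integrals, which is stronger than
the geometric one.\<close>

lemma prekopa_leindler_real_normalised:
  fixes u v w :: "real \<Rightarrow> real"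
  assumes [measurable]: "u \<in> borel_measurable borel" "v \<in> borel_measurable borel" "w \<in> borel_measurable borel"
    and u: "\<And>x. 0 \<le> u x" "\<And>x. u x \<le> 1" "\<And>l. l < 1 \<Longrightarrow> \<exists>x. l < u x"
    and v: "\<And>x. 0 \<le> v x" "\<And>x. v x \<le> 1" "\<And>l. l < 1 \<Longrightarrow> \<exists>x. l < v x"
    and w: "\<And>x. 0 \<le> w x" "\<And>x. w x \<le> 1"
    and t: "0 < t" "t < 1"
    and le: "\<And>x y l. 0 < l \<Longrightarrow> l < 1 \<Longrightarrow> l < u x \<Longrightarrow> l < v y \<Longrightarrow> l < w (t * x + (1 - t) * y)"
  shows "ennreal t * (\<integral>\<^sup>+x. u x \<partial>lborel) + ennreal (1 - t) * (\<integral>\<^sup>+x. v x \<partial>lborel) \<le> (\<integral>\<^sup>+x. w x \<partial>lborel)"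
proof -
  have [measurable]: "(\<lambda>l. emeasure lborel {x. l < f x}) \<in> borel_measurable lborel"
    if [measurable]: "f \<in> borel_measurable borel" for f :: "real \<Rightarrow> real"
  proof -
    have "(\<lambda>l. \<integral>\<^sup>+x. indicator {x. l < f x} x \<partial>lborel) \<in> borel_measurable lborel"
      unfolding indicator_def by measurable
    then show ?thesis by simp
  qed
  have "ennreal t * (\<integral>\<^sup>+x. u x \<partial>lborel) + ennreal (1 - t) * (\<integral>\<^sup>+x. v x \<partial>lborel) =
    (\<integral>\<^sup>+l. (ennreal t * emeasure lborel {x. l < u x} + ennreal (1 - t) * emeasure lborel {x. l < v x})
        * indicator {0<..<1} l \<partial>lborel)"
    by (simp add: nn_integral_layer_cake_unit u v nn_integral_cmult[symmetric] nn_integral_add[symmetric]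
        distrib_right mult.assoc)
  also have "\<dots> \<le> (\<integral>\<^sup>+l. emeasure lborel {x. l < w x} * indicator {0<..<1} l \<partial>lborel)"
  proof (intro nn_integral_mono)
    fix l :: real
    show "(ennreal t * emeasure lborel {x. l < u x} + ennreal (1 - t) * emeasure lborel {x. l < v x})
        * indicator {0<..<1} l \<le> emeasure lborel {x. l < w x} * indicator {0<..<1} l"
    proof (cases "l \<in> {0<..<1}")
      case True
      have "ennreal t * emeasure lborel {x. l < u x} + ennreal (1 - t) * emeasure lborel {x. l < v x}
        \<le> emeasure lborel {x. l < w x}"
        using True u(3)[of l] v(3)[of l] t le by (intro brunn_minkowski_real) auto
      then show ?thesis using True by simp
    qed auto
  qed
  also have "\<dots> = (\<integral>\<^sup>+x. w x \<partial>lborel)"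
    by (simp add: nn_integral_layer_cake_unit w)
  finally show ?thesis .
qed

text \<open>Dividing \<open>u\<close> and \<open>v\<close> by their suprema \<open>A\<close> and \<open>B\<close>, and \<open>w\<close> by \<open>C = A\<^sup>t B\<^sup>1\<^sup>-\<^sup>t\<close>, reduces to the
normalised case; Young's inequality then returns from the arithmetic to the geometric mean,
and the scaling factors cancel.\<close>

lemma prekopa_leindler_real_bounded:
  fixes u v :: "real \<Rightarrow> real" and w :: "real \<Rightarrow> ennreal"
  assumes [measurable]: "u \<in> borel_measurable borel" "v \<in> borel_measurable borel" "w \<in> borel_measurable borel"
    and u: "\<And>x. 0 \<le> u x" "bdd_above (range u)" and v: "\<And>x. 0 \<le> v x" "bdd_above (range v)"
    and t: "0 < t" "t < 1"
    and le: "\<And>x y. ennreal (u x powr t * v y powr (1 - t)) \<le> w (t * x + (1 - t) * y)"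
    and ab: "0 < a" "0 < b" "ennreal a \<le> (\<integral>\<^sup>+x. u x \<partial>lborel)" "ennreal b \<le> (\<integral>\<^sup>+x. v x \<partial>lborel)"
  shows "ennreal (a powr t * b powr (1 - t)) \<le> (\<integral>\<^sup>+x. w x \<partial>lborel)"
proof -
  define A where "A = (SUP x. u x)"
  define B where "B = (SUP x. v x)"
  have uA: "u x \<le> A" and vB: "v x \<le> B" for x
    unfolding A_def B_def using u v by (auto intro: cSUP_upper)
  have pos: "0 < c" if "0 < d" "ennreal d \<le> (\<integral>\<^sup>+x. f x \<partial>lborel)" "\<And>x. f x \<le> c"
    for f :: "real \<Rightarrow> real" and c d :: real
  proof (rule ccontr)
    assume "\<not> 0 < c"
    then have "ennreal (f x) = 0" for x using that(3)[of x] by (simp add: ennreal_eq_0_iff)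
    then show False using that(1,2) by simp
  qed
  have A: "0 < A" and B: "0 < B" using pos ab uA vB by blast+
  define C where "C = A powr t * B powr (1 - t)"
  have C: "0 < C" using A B by (simp add: C_def)
  define w' where "w' x = enn2real (min (w x) (ennreal C)) / C" for x
  have [measurable]: "w' \<in> borel_measurable borel" unfolding w'_def by measurable
  have w'_eq: "ennreal (C * w' x) = min (w x) (ennreal C)" for x
  proof -
    have "min (w x) (ennreal C) < top" by (simp add: min_less_iff_disj)
    then show ?thesis unfolding w'_def using C by simp
  qed
  have w'0: "0 \<le> w' x" for x using C by (simp add: w'_def)
  have w'1: "w' x \<le> 1" for x
  proof -
    have "ennreal (C * w' x) \<le> ennreal C" unfolding w'_eq by simp
    then show ?thesis using C by simp
  qed
  have "ennreal t * (\<integral>\<^sup>+x. ennreal (u x / A) \<partial>lborel) + ennreal (1 - t) * (\<integral>\<^sup>+x. ennreal (v x / B) \<partial>lborel)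
    \<le> (\<integral>\<^sup>+x. w' x \<partial>lborel)"
  proof (rule prekopa_leindler_real_normalised)
    show "\<exists>x. l < u x / A" if "l < 1" for l
    proof -
      have "l * A < A" using that A by simp
      then have "\<exists>x. l * A < u x" using less_cSUP_iff[of UNIV u "l * A"] u(2) by (simp add: A_def)
      then show ?thesis using A by (simp add: pos_less_divide_eq)
    qed
    show "\<exists>x. l < v x / B" if "l < 1" for l
    proof -
      have "l * B < B" using that B by simp
      then have "\<exists>x. l * B < v x" using less_cSUP_iff[of UNIV v "l * B"] v(2) by (simp add: B_def)
      then show ?thesis using B by (simp add: pos_less_divide_eq)
    qed
    fix x y l :: real assume l: "0 < l" "l < 1" "l < u x / A" "l < v y / B"
    have "l * A < u x" "l * B < v y" using l A B by (auto simp: pos_less_divide_eq)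
    then have "(l * A) powr t * (l * B) powr (1 - t) < u x powr t * v y powr (1 - t)"
      using l t A B by (intro mult_strict_mono powr_less_mono2) auto
    moreover have "(l * A) powr t * (l * B) powr (1 - t) = l powr (t + (1 - t)) * C"
      unfolding C_def powr_add using l A B by (simp add: powr_mult)
    ultimately have "l * C < u x powr t * v y powr (1 - t)" using l by simp
    then have "ennreal (l * C) < w (t * x + (1 - t) * y)"
      using le[of x y] l C by (intro less_le_trans[OF _ le]) (simp add: ennreal_less_iff)
    moreover have "ennreal (l * C) < ennreal C" using l C by (intro ennreal_lessI) auto
    ultimately have "ennreal (l * C) < ennreal (C * w' (t * x + (1 - t) * y))"
      unfolding w'_eq by simp
    then show "l < w' (t * x + (1 - t) * y)"
      using l C by (simp add: ennreal_less_iff mult.commute)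
  qed (use u v uA vB A B w'0 w'1 t in auto)
  moreover have scale: "ennreal (d / c) \<le> (\<integral>\<^sup>+x. ennreal (f x / c) \<partial>lborel)"
    if "0 < c" "ennreal d \<le> (\<integral>\<^sup>+x. f x \<partial>lborel)" "0 \<le> d" "\<And>x. 0 \<le> f x"
      and [measurable]: "f \<in> borel_measurable borel"
    for f :: "real \<Rightarrow> real" and c d :: real
    using that by (simp add: divide_ennreal[symmetric] nn_integral_divide divide_right_mono_ennreal)
  ultimately have "ennreal t * ennreal (a / A) + ennreal (1 - t) * ennreal (b / B) \<le> (\<integral>\<^sup>+x. w' x \<partial>lborel)"
    using ab A B u v by (elim order.trans[rotated]) (intro add_mono mult_left_mono scale; auto)
  moreover have "ennreal ((a / A) powr t * (b / B) powr (1 - t)) \<le> ennreal t * ennreal (a / A) + ennreal (1 - t) * ennreal (b / B)"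
    using Youngs_inequality_0[of t "1 - t" "a / A" "b / B"] ab A B t
    by (simp add: ennreal_mult[symmetric] ennreal_plus[symmetric] del: ennreal_plus)
  ultimately have "ennreal C * ennreal ((a / A) powr t * (b / B) powr (1 - t)) \<le> ennreal C * (\<integral>\<^sup>+x. w' x \<partial>lborel)"
    by (intro mult_left_mono) auto
  also have "\<dots> = (\<integral>\<^sup>+x. ennreal (C * w' x) \<partial>lborel)"
    using C by (subst nn_integral_cmult[symmetric]) (auto simp: ennreal_mult w'0)
  also have "\<dots> \<le> (\<integral>\<^sup>+x. w x \<partial>lborel)"
    by (intro nn_integral_mono) (simp add: w'_eq)
  also have "ennreal C * ennreal ((a / A) powr t * (b / B) powr (1 - t)) = ennreal (a powr t * b powr (1 - t))"
    using A B ab C by (simp add: ennreal_mult[symmetric] C_def powr_divide)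
  finally show ?thesis .
qed

lemma nn_integral_truncate_approx:
  fixes f :: "'a \<Rightarrow> ennreal"
  assumes [measurable]: "f \<in> borel_measurable M" and a: "a < (\<integral>\<^sup>+x. f x \<partial>M)"
  obtains k :: nat where "a < (\<integral>\<^sup>+x. min (f x) (of_nat k) \<partial>M)"
proof -
  have "(SUP k. min (f x) (of_nat k)) = f x" for x
  proof -
    have "(SUP k. min (f x) (of_nat k :: ennreal)) = min (f x) (SUP k. of_nat k)"
      by (simp add: min_of_mono inf_min[symmetric] inf_SUP)
    then show ?thesis by (simp add: ennreal_SUP_of_nat_eq_top)
  qed
  then have "(\<integral>\<^sup>+x. f x \<partial>M) = (SUP k. \<integral>\<^sup>+x. min (f x) (of_nat k) \<partial>M)"
    by (subst nn_integral_monotone_convergence_SUP[symmetric])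
      (auto simp: incseq_def le_fun_def intro: min.coboundedI2)
  then show thesis using a that by (auto simp: less_SUP_iff)
qed

theorem prekopa_leindler_real:
  fixes u v w :: "real \<Rightarrow> ennreal"
  assumes [measurable]: "u \<in> borel_measurable borel" "v \<in> borel_measurable borel" "w \<in> borel_measurable borel"
    and t: "0 < t" "t < 1"
    and le: "\<And>x y. geometric_mean_le t (u x) (v y) (w (t * x + (1 - t) * y))"
  shows "geometric_mean_le t (\<integral>\<^sup>+x. u x \<partial>lborel) (\<integral>\<^sup>+x. v x \<partial>lborel) (\<integral>\<^sup>+x. w x \<partial>lborel)"
  unfolding geometric_mean_le_def
proof (intro allI impI)
  fix a b :: real
  assume ab: "0 \<le> a" "0 \<le> b" "ennreal a \<le> (\<integral>\<^sup>+x. u x \<partial>lborel)" "ennreal b \<le> (\<integral>\<^sup>+x. v x \<partial>lborel)"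
  have *: "ennreal (a' powr t * b' powr (1 - t)) \<le> (\<integral>\<^sup>+x. w x \<partial>lborel)"
    if ab': "0 < a'" "a' < a" "0 < b'" "b' < b" for a' b'
  proof -
    have lt: "ennreal a' < (\<integral>\<^sup>+x. u x \<partial>lborel)" "ennreal b' < (\<integral>\<^sup>+x. v x \<partial>lborel)"
      using ab ab' by (meson ennreal_lessI less_le_trans less_trans)+
    obtain k where k: "ennreal a' < (\<integral>\<^sup>+x. min (u x) (of_nat k) \<partial>lborel)"
      by (rule nn_integral_truncate_approx[OF _ lt(1)]) auto
    obtain l where l: "ennreal b' < (\<integral>\<^sup>+x. min (v x) (of_nat l) \<partial>lborel)"
      by (rule nn_integral_truncate_approx[OF _ lt(2)]) auto
    define tr where "tr f m x = enn2real (min (f x) (of_nat m))" for f :: "real \<Rightarrow> ennreal" and m :: nat and x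
    have tr: "ennreal (tr f m x) = min (f x) (of_nat m)" for f m x
    proof -
      have "min (f x) (of_nat m :: ennreal) < top" by (simp add: min_less_iff_disj of_nat_less_top)
      then show ?thesis by (simp add: tr_def)
    qed
    have trm: "tr f m x \<le> real m" for f m x
    proof -
      have "ennreal (tr f m x) \<le> ennreal (real m)" unfolding tr by (simp add: ennreal_of_nat_eq_real_of_nat)
      then show ?thesis by simp
    qed
    show ?thesis
    proof (rule prekopa_leindler_real_bounded[where u = "tr u k" and v = "tr v l"])
      show "bdd_above (range (tr u k))" "bdd_above (range (tr v l))"
        using trm by (auto intro!: bdd_aboveI)
      show "ennreal (tr u k x powr t * tr v l y powr (1 - t)) \<le> w (t * x + (1 - t) * y)" for x y
        using le[of x y] tr[of u k x] tr[of v l y] unfolding geometric_mean_le_def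
        by (auto simp: tr_def)
      show "tr u k \<in> borel_measurable borel" "tr v l \<in> borel_measurable borel"
        unfolding tr_def by measurable
      show "ennreal a' \<le> (\<integral>\<^sup>+x. tr u k x \<partial>lborel)" "ennreal b' \<le> (\<integral>\<^sup>+x. tr v l x \<partial>lborel)"
        unfolding tr using k l by auto
    qed (use t ab' in \<open>auto simp: tr_def\<close>)
  qed
  show "ennreal (a powr t * b powr (1 - t)) \<le> (\<integral>\<^sup>+x. w x \<partial>lborel)"
  proof (cases "a = 0 \<or> b = 0")
    case False
    then have ab0: "0 < a" "0 < b" using ab by auto
    have "((\<lambda>r. ennreal ((r * a) powr t * (r * b) powr (1 - t))) \<longlongrightarrow> ennreal ((1 * a) powr t * (1 * b) powr (1 - t)))
       (at_left 1)"
      using ab0 by (intro tendsto_intros) auto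
    moreover have "eventually (\<lambda>r::real. r \<in> {0<..<1}) (at_left 1)"
      by (rule eventually_at_leftI[of 0]) auto
    then have "eventually (\<lambda>r. ennreal ((r * a) powr t * (r * b) powr (1 - t)) \<le> (\<integral>\<^sup>+x. w x \<partial>lborel)) (at_left (1::real))"
      by eventually_elim (use ab0 in \<open>auto intro!: *\<close>)
    ultimately have "ennreal ((1 * a) powr t * (1 * b) powr (1 - t)) \<le> (\<integral>\<^sup>+x. w x \<partial>lborel)"
      by (rule tendsto_upperbound) simp
    then show ?thesis by simp
  qed auto
qed

text \<open>Induction on the number of coordinates: for fixed values of the new coordinate the induction
hypothesis compares the integrals over the slices, and the one-dimensional inequality
compares the integrals of these slice functions.\<close>

theorem prekopa_leindler_PiM:
  fixes u v w :: "('i \<Rightarrow> real) \<Rightarrow> ennreal"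
  assumes "finite I"
    and "u \<in> borel_measurable (\<Pi>\<^sub>M i\<in>I. lborel)" "v \<in> borel_measurable (\<Pi>\<^sub>M i\<in>I. lborel)"
      "w \<in> borel_measurable (\<Pi>\<^sub>M i\<in>I. lborel)"
    and t: "0 < t" "t < 1"
    and "\<And>x y. x \<in> extensional I \<Longrightarrow> y \<in> extensional I \<Longrightarrow>
      geometric_mean_le t (u x) (v y) (w (\<lambda>i\<in>I. t * x i + (1 - t) * y i))"
  shows "geometric_mean_le t (\<integral>\<^sup>+x. u x \<partial>(\<Pi>\<^sub>M i\<in>I. lborel)) (\<integral>\<^sup>+x. v x \<partial>(\<Pi>\<^sub>M i\<in>I. lborel))
    (\<integral>\<^sup>+x. w x \<partial>(\<Pi>\<^sub>M i\<in>I. lborel))"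
  using assms(1-4,7)
proof (induction I arbitrary: u v w rule: finite_induct)
  case empty
  then show ?case
    by (simp add: PiM_empty nn_integral_count_space_finite restrict_def)
next
  case (insert j J)
  interpret product_sigma_finite "\<lambda>_::'i. lborel :: real measure" ..
  note [measurable] = insert.prems(1-3)
  have upd: "(\<lambda>x. f (x(j := r))) \<in> borel_measurable (\<Pi>\<^sub>M i\<in>J. lborel)"
    if [measurable]: "f \<in> borel_measurable (\<Pi>\<^sub>M i\<in>insert j J. lborel)" for f :: "('i \<Rightarrow> real) \<Rightarrow> ennreal" and r :: real
    by measurable
  have slice: "(\<lambda>r. \<integral>\<^sup>+x. f (x(j := r)) \<partial>(\<Pi>\<^sub>M i\<in>J. lborel)) \<in> borel_measurable borel"
    if [measurable]: "f \<in> borel_measurable (\<Pi>\<^sub>M i\<in>insert j J. lborel)" for f :: "('i \<Rightarrow> real) \<Rightarrow> ennreal"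
  proof -
    interpret J: sigma_finite_measure "\<Pi>\<^sub>M i\<in>J. (lborel :: real measure)"
      by (rule sigma_finite) (rule insert.hyps)
    have "(\<lambda>(r, x). f (x(j := r))) \<in> borel_measurable (borel \<Otimes>\<^sub>M (\<Pi>\<^sub>M i\<in>J. lborel))"
      unfolding split_beta' by measurable
    then show ?thesis using J.borel_measurable_nn_integral[of "\<lambda>r x. f (x(j := r))"] by simp
  qed
  show ?case
    unfolding product_nn_integral_insert_rev[OF insert.hyps(1,2) insert.prems(1)]
      product_nn_integral_insert_rev[OF insert.hyps(1,2) insert.prems(2)]
      product_nn_integral_insert_rev[OF insert.hyps(1,2) insert.prems(3)]
  proof (intro prekopa_leindler_real slice insert.prems(1-3) t insert.IH upd)
    fix r q :: real and x y :: "'i \<Rightarrow> real"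
    assume "x \<in> extensional J" "y \<in> extensional J"
    then have "x(j := r) \<in> extensional (insert j J)" "y(j := q) \<in> extensional (insert j J)"
      by (auto simp: extensional_def)
    from insert.prems(4)[OF this]
    have "geometric_mean_le t (u (x(j := r))) (v (y(j := q)))
      (w (\<lambda>i\<in>insert j J. t * (x(j := r)) i + (1 - t) * (y(j := q)) i))" .
    also have "(\<lambda>i\<in>insert j J. t * (x(j := r)) i + (1 - t) * (y(j := q)) i) =
      (\<lambda>i\<in>J. t * x i + (1 - t) * y i)(j := t * r + (1 - t) * q)"
      using insert.hyps by (auto simp: restrict_def fun_eq_iff)
    finally show "geometric_mean_le t (u (x(j := r))) (v (y(j := q)))
      (w ((\<lambda>i\<in>J. t * x i + (1 - t) * y i)(j := t * r + (1 - t) * q)))" .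
  qed
qed

theorem prekopa_leindler:
  fixes u v w :: "'a::euclidean_space \<Rightarrow> ennreal"
  assumes [measurable]: "u \<in> borel_measurable borel" "v \<in> borel_measurable borel" "w \<in> borel_measurable borel"
    and t: "0 < t" "t < 1"
    and le: "\<And>x y. geometric_mean_le t (u x) (v y) (w (t *\<^sub>R x + (1 - t) *\<^sub>R y))"
  shows "geometric_mean_le t (\<integral>\<^sup>+x. u x \<partial>lborel) (\<integral>\<^sup>+x. v x \<partial>lborel) (\<integral>\<^sup>+x. w x \<partial>lborel)"
proof -
  define T :: "('a \<Rightarrow> real) \<Rightarrow> 'a" where "T f = (\<Sum>b\<in>Basis. f b *\<^sub>R b)" for f
  have T[measurable]: "T \<in> measurable (\<Pi>\<^sub>M b\<in>Basis. lborel) borel"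
    unfolding T_def by measurable
  have lborel: "lborel = distr (\<Pi>\<^sub>M b\<in>Basis. lborel) borel T"
    unfolding T_def by (rule lborel_eq)
  have int: "(\<integral>\<^sup>+x. f x \<partial>lborel) = (\<integral>\<^sup>+x. f (T x) \<partial>(\<Pi>\<^sub>M b\<in>Basis. lborel))"
    if [measurable]: "f \<in> borel_measurable borel" for f :: "'a \<Rightarrow> ennreal"
    unfolding lborel by (subst nn_integral_distr) auto
  show ?thesis
    unfolding int[OF assms(1)] int[OF assms(2)] int[OF assms(3)]
  proof (rule prekopa_leindler_PiM)
    fix x y :: "'a \<Rightarrow> real"
    have "T (\<lambda>i\<in>Basis. t * x i + (1 - t) * y i) = t *\<^sub>R T x + (1 - t) *\<^sub>R T y"
      by (simp add: T_def scaleR_sum_right sum.distrib[symmetric] scaleR_add_left)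
    then show "geometric_mean_le t (u (T x)) (v (T y)) (w (T (\<lambda>i\<in>Basis. t * x i + (1 - t) * y i)))"
      using le by simp
  qed (use t in auto)
qed

section \<open>Gaussian mixtures are strongly log-concave\<close>

text \<open>For \<open>p = exp (- V)\<close> with smooth \<open>V\<close> this says that the Hessian of \<open>V\<close> is at least \<open>c\<close> times the
identity.\<close>

definition strongly_log_concave :: "real \<Rightarrow> ('a::real_normed_vector \<Rightarrow> real) \<Rightarrow> bool" where
  "strongly_log_concave c p \<longleftrightarrow>
     (\<forall>x y t. 0 < t \<longrightarrow> t < 1 \<longrightarrow>
        p x powr t * p y powr (1 - t) \<le>
        p (t *\<^sub>R x + (1 - t) *\<^sub>R y) * exp (- (c / 2) * (t * (1 - t)) * (norm (x - y))\<^sup>2))"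

text \<open>The Hessian of \<open>- ln p\<close> at \<open>z\<close> is \<open>1 / \<delta>\<close> minus \<open>1 / \<delta>\<^sup>2\<close> times the covariance of the measure \<open>\<mu>\<close>
tilted by the Gaussian weight \<open>e z\<close>, and the covariance of a measure on a ball of radius \<open>R\<close> is at
most \<open>R\<^sup>2\<close>. The proof replaces second derivatives by Hoeffding's lemma: along a line through \<open>z\<close>,
\<open>p (z + r d) / p z\<close> is, up to a Gaussian factor, the exponential moment of a bounded random
variable under the tilted measure, and Hoeffding's bound has exactly the constant that the
covariance bound predicts. Using it at both endpoints of a segment through \<open>z\<close>, the linear terms
cancel.\<close>

theorem strongly_log_concave_gaussian_mixture:
  fixes \<mu> :: "'a::euclidean_space measure"
  assumes "prob_space \<mu>" and sets[measurable_cong]: "sets \<mu> = sets borel"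
    and supp: "AE \<xi> in \<mu>. norm (\<xi> - a) \<le> R" and \<delta>: "0 < \<delta>" and K: "0 < K"
  shows "strongly_log_concave (1 / \<delta> - R\<^sup>2 / \<delta>\<^sup>2) (\<lambda>z. \<integral>\<xi>. K * exp (- (norm (z - \<xi>))\<^sup>2 / (2 * \<delta>)) \<partial>\<mu>)"
proof -
  interpret \<mu>: prob_space \<mu> by fact
  define e where "e z \<xi> = K * exp (- (norm (z - \<xi>))\<^sup>2 / (2 * \<delta>))" for z \<xi> :: 'a
  define p where "p z = (\<integral>\<xi>. e z \<xi> \<partial>\<mu>)" for z
  define c where "c = 1 / \<delta> - R\<^sup>2 / \<delta>\<^sup>2"
  have [measurable]: "e z \<in> borel_measurable borel" for z unfolding e_def by measurable
  have e_pos: "0 < e z \<xi>" for z \<xi> using K by (simp add: e_def)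
  have e_int: "integrable \<mu> (e z)" for z
    by (rule \<mu>.integrable_const_bound[where B = K]) (use K \<delta> in \<open>auto simp: e_def mult_le_cancel_left2\<close>)
  have p_pos: "0 < p z" for z
  proof -
    have "p z \<noteq> 0"
    proof
      assume "p z = 0"
      then have "AE \<xi> in \<mu>. e z \<xi> = 0"
        unfolding p_def using e_pos by (subst (asm) integral_nonneg_eq_0_iff_AE) (auto simp: e_int less_imp_le)
      then have "AE \<xi> in \<mu>. False" using e_pos by (auto simp: less_le)
      then show False by simp
    qed
    moreover have "0 \<le> p z" unfolding p_def using e_pos by (intro Bochner_Integration.integral_nonneg) (simp add: less_imp_le)
    ultimately show ?thesis by simp
  qed
  \<comment> \<open>the derivative of \<open>ln p\<close> at \<open>z\<close> in direction \<open>d\<close>, as a mean under the tilted measure\<close>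
  define F where "F z d = (\<integral>\<xi>. e z \<xi> / p z * ((d \<bullet> (\<xi> - z)) / \<delta>) \<partial>\<mu>)" for z d
  have F_minus: "F z (- d) = - F z d" for z d
    unfolding F_def by (subst Bochner_Integration.integral_minus[symmetric]) simp
  have shift: "p (z + r *\<^sub>R d) \<le> p z * exp (r * F z d - r\<^sup>2 * (norm d)\<^sup>2 * (c / 2))" if r: "0 < r" for z d r
  proof -
    define M where "M = density \<mu> (\<lambda>\<xi>. ennreal (e z \<xi> / p z))"
    define f where "f \<xi> = (d \<bullet> (\<xi> - z)) / \<delta>" for \<xi>
    define m where "m = (d \<bullet> (a - z)) / \<delta>"
    define w where "w = norm d * R / \<delta>"
    have [measurable]: "f \<in> borel_measurable borel" unfolding f_def by measurable
    interpret M: prob_space M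
    proof
      have "emeasure M (space M) = (\<integral>\<^sup>+\<xi>. ennreal (e z \<xi> / p z) \<partial>\<mu>)"
        unfolding M_def by (simp add: emeasure_density cong: nn_integral_cong)
      also have "\<dots> = ennreal (\<integral>\<xi>. e z \<xi> / p z \<partial>\<mu>)"
        using e_pos p_pos e_int by (intro nn_integral_eq_integral) (auto simp: less_imp_le)
      also have "\<dots> = 1" using p_pos[of z] by (simp add: p_def)
      finally show "emeasure M (space M) = 1" .
    qed
    interpret interval_bounded_random_variable M f "m - w" "m + w"
    proof
      show "f \<in> borel_measurable M" unfolding M_def by simp
      have "AE \<xi> in \<mu>. f \<xi> \<in> {m - w..m + w}"
        using supp
      proof eventually_elim
        fix \<xi> assume \<xi>: "norm (\<xi> - a) \<le> R"
        have "\<bar>d \<bullet> (\<xi> - a)\<bar> \<le> norm d * R"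
          using Cauchy_Schwarz_ineq2[of d "\<xi> - a"] \<xi> mult_left_mono[OF \<xi>, of "norm d"] by simp
        moreover have "f \<xi> - m = (d \<bullet> (\<xi> - a)) / \<delta>"
          unfolding f_def m_def by (simp add: inner_diff_right diff_divide_distrib)
        ultimately have "\<bar>f \<xi> - m\<bar> \<le> w"
          unfolding w_def using \<delta> by (simp add: divide_right_mono)
        then show "f \<xi> \<in> {m - w..m + w}" by (auto simp: abs_le_iff)
      qed
      then show "AE \<xi> in M. f \<xi> \<in> {m - w..m + w}"
        unfolding M_def by (subst AE_density) auto
    qed
    have Ef: "M.expectation f = F z d"
      unfolding M_def F_def f_def
      by (subst integral_real_density) (use e_pos p_pos in \<open>auto simp: less_imp_le\<close>)
    have split: "e (z + r *\<^sub>R d) \<xi> =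
        (p z * exp (r * F z d - r\<^sup>2 * (norm d)\<^sup>2 / (2 * \<delta>))) * (e z \<xi> / p z * exp (r * (f \<xi> - F z d)))" for \<xi>
    proof -
      have n: "(norm (z + r *\<^sub>R d - \<xi>))\<^sup>2 = (norm (z - \<xi>))\<^sup>2 - 2 * r * (d \<bullet> (\<xi> - z)) + r\<^sup>2 * (norm d)\<^sup>2"
        unfolding power2_norm_eq_inner
        by (simp add: inner_simps algebra_simps inner_commute power2_eq_square)
      have "- (norm (z + r *\<^sub>R d - \<xi>))\<^sup>2 / (2 * \<delta>) =
        - (norm (z - \<xi>))\<^sup>2 / (2 * \<delta>) + (r * F z d - r\<^sup>2 * (norm d)\<^sup>2 / (2 * \<delta>)) + r * (f \<xi> - F z d)"
        unfolding n f_def using \<delta> by (simp add: field_simps)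
      then have "e (z + r *\<^sub>R d) \<xi> = K * (exp (- (norm (z - \<xi>))\<^sup>2 / (2 * \<delta>)) *
        exp (r * F z d - r\<^sup>2 * (norm d)\<^sup>2 / (2 * \<delta>)) * exp (r * (f \<xi> - F z d)))"
        unfolding e_def exp_add[symmetric] by (simp only:)
      then show ?thesis
        using p_pos[of z] unfolding e_def[of z] by simp
    qed
    have "ennreal (p (z + r *\<^sub>R d)) = (\<integral>\<^sup>+\<xi>. ennreal (e (z + r *\<^sub>R d) \<xi>) \<partial>\<mu>)"
      unfolding p_def using e_pos e_int by (intro nn_integral_eq_integral[symmetric]) (auto simp: less_imp_le)
    also have "\<dots> = ennreal (p z * exp (r * F z d - r\<^sup>2 * (norm d)\<^sup>2 / (2 * \<delta>))) *
        (\<integral>\<^sup>+\<xi>. ennreal (e z \<xi> / p z) * ennreal (exp (r * (f \<xi> - F z d))) \<partial>\<mu>)"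
      unfolding split using e_pos p_pos
      by (subst nn_integral_cmult[symmetric])
        (simp_all add: ennreal_mult'[symmetric] ennreal_mult''[symmetric] less_imp_le mult.assoc)
    also have "(\<integral>\<^sup>+\<xi>. ennreal (e z \<xi> / p z) * ennreal (exp (r * (f \<xi> - F z d))) \<partial>\<mu>) =
        (\<integral>\<^sup>+\<xi>. ennreal (exp (r * (f \<xi> - F z d))) \<partial>M)"
      unfolding M_def by (subst nn_integral_density) auto
    also have "\<dots> \<le> ennreal (exp (r\<^sup>2 * ((m + w) - (m - w))\<^sup>2 / 8))"
      using Hoeffdings_lemma_nn_integral[OF r] unfolding Ef by simp
    finally have "ennreal (p (z + r *\<^sub>R d)) \<le>
      ennreal (p z * exp (r * F z d - r\<^sup>2 * (norm d)\<^sup>2 / (2 * \<delta>)) * exp (r\<^sup>2 * ((m + w) - (m - w))\<^sup>2 / 8))"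
      using p_pos[of z] by (simp add: ennreal_mult mult_left_mono)
    also have "p z * exp (r * F z d - r\<^sup>2 * (norm d)\<^sup>2 / (2 * \<delta>)) * exp (r\<^sup>2 * ((m + w) - (m - w))\<^sup>2 / 8) =
      p z * exp (r * F z d - r\<^sup>2 * (norm d)\<^sup>2 * (c / 2))"
      using \<delta> unfolding mult.assoc exp_add[symmetric] w_def c_def
      by (simp add: field_simps power2_eq_square)
    finally show ?thesis using p_pos[of z] by (simp add: ennreal_le_iff)
  qed
  have "p x powr t * p y powr (1 - t) \<le> p (t *\<^sub>R x + (1 - t) *\<^sub>R y) * exp (- (c / 2) * (t * (1 - t)) * (norm (x - y))\<^sup>2)"
    if t: "0 < t" "t < 1" for x y t
  proof -
    define z where "z = t *\<^sub>R x + (1 - t) *\<^sub>R y"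
    define N where "N = (norm (x - y))\<^sup>2"
    have x: "x = z + (1 - t) *\<^sub>R (x - y)" and y: "y = z + t *\<^sub>R (- (x - y))"
      unfolding z_def by (simp_all add: algebra_simps)
    have px: "p x \<le> p z * exp ((1 - t) * F z (x - y) - (1 - t)\<^sup>2 * N * (c / 2))"
      using shift[of "1 - t" z "x - y"] t x unfolding N_def by simp
    have py: "p y \<le> p z * exp (- (t * F z (x - y)) - t\<^sup>2 * N * (c / 2))"
      using shift[of t z "- (x - y)"] t y unfolding N_def F_minus norm_minus_cancel by simp
    have "p x powr t * p y powr (1 - t) \<le>
      (p z * exp ((1 - t) * F z (x - y) - (1 - t)\<^sup>2 * N * (c / 2))) powr t *
      (p z * exp (- (t * F z (x - y)) - t\<^sup>2 * N * (c / 2))) powr (1 - t)"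
      using t px py p_pos[of x] p_pos[of y] by (intro mult_mono powr_mono2) auto
    also have "\<dots> = (p z powr t * p z powr (1 - t)) *
       (exp (t * ((1 - t) * F z (x - y) - (1 - t)\<^sup>2 * N * (c / 2))) *
        exp ((1 - t) * (- (t * F z (x - y)) - t\<^sup>2 * N * (c / 2))))"
      using p_pos[of z] by (simp add: powr_mult exp_powr_real mult_ac)
    also have "p z powr t * p z powr (1 - t) = p z"
      using p_pos[of z] by (simp flip: powr_add)
    also have "exp (t * ((1 - t) * F z (x - y) - (1 - t)\<^sup>2 * N * (c / 2))) *
        exp ((1 - t) * (- (t * F z (x - y)) - t\<^sup>2 * N * (c / 2))) = exp (- (c / 2) * (t * (1 - t)) * N)"
      unfolding exp_add[symmetric] by (simp add: field_simps power2_eq_square)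
    finally show ?thesis unfolding z_def N_def .
  qed
  then show ?thesis
    unfolding strongly_log_concave_def p_def e_def c_def by blast
qed

lemma prob_space_gaussian_measure:
  assumes "0 < \<delta>"
  shows "prob_space (gaussian_measure \<delta> :: (real ^ 'n) measure)"
proof
  let ?f = "\<lambda>x::real^'n. (2 * pi * \<delta>) powr (- (real CARD('n) / 2)) * exp (- (norm x)\<^sup>2 / (2 * \<delta>))"
  have prod: "?f x = (\<Prod>b\<in>Basis. normal_density 0 (sqrt \<delta>) (x \<bullet> b))" for x
  proof -
    have "(\<Prod>b\<in>Basis. normal_density 0 (sqrt \<delta>) (x \<bullet> b)) =
      (1 / sqrt (2 * pi * \<delta>)) ^ CARD('n) * exp (\<Sum>b\<in>Basis. - (x \<bullet> b)\<^sup>2 / (2 * \<delta>))"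
      using assms unfolding normal_density_def prod.distrib exp_sum[OF finite_Basis] by simp
    also have "(\<Sum>b\<in>Basis. - (x \<bullet> b)\<^sup>2 / (2 * \<delta>)) = - (norm x)\<^sup>2 / (2 * \<delta>)"
      unfolding power2_norm_eq_inner euclidean_inner[of x x]
      by (simp add: sum_divide_distrib[symmetric] sum_negf power2_eq_square)
    also have "(1 / sqrt (2 * pi * \<delta>)) ^ CARD('n) = (2 * pi * \<delta>) powr (- (real CARD('n) / 2))"
      using assms by (simp add: powr_minus powr_half_sqrt[symmetric] powr_powr powr_realpow[symmetric] divide_simps)
    finally show ?thesis by simp
  qed
  have "emeasure (gaussian_measure \<delta> :: (real^'n) measure) (space (gaussian_measure \<delta>)) = (\<integral>\<^sup>+x. ennreal (?f x) \<partial>lborel)"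
    unfolding gaussian_measure_def by (simp add: emeasure_density)
  also have "\<dots> = (\<integral>\<^sup>+x. (\<Prod>b\<in>(Basis :: (real^'n) set). ennreal (normal_density 0 (sqrt \<delta>) (x \<bullet> b))) \<partial>lborel)"
    unfolding prod using assms by (simp add: prod_ennreal)
  also have "\<dots> = (\<Prod>b\<in>(Basis :: (real^'n) set). \<integral>\<^sup>+x. normal_density 0 (sqrt \<delta>) x \<partial>lborel)"
    by (rule nn_integral_lborel_prod) auto
  also have "\<dots> = 1"
    using assms by (subst nn_integral_eq_integral) auto
  finally show "emeasure (gaussian_measure \<delta> :: (real^'n) measure) (space (gaussian_measure \<delta>)) = 1" .
qed

lemma convolution_gaussian_eq_density:
  fixes \<mu> :: "(real ^ 'n) measure"
  assumes "prob_space \<mu>" and sets[measurable_cong]: "sets \<mu> = sets borel" and \<delta>: "0 < \<delta>"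
  defines "p \<equiv> \<lambda>z. \<integral>\<xi>. (2 * pi * \<delta>) powr (- (real CARD('n) / 2)) * exp (- (norm (z - \<xi>))\<^sup>2 / (2 * \<delta>)) \<partial>\<mu>"
  shows "p \<in> borel_measurable borel"
    and "convolution \<mu> (gaussian_measure \<delta>) = density lborel (\<lambda>z. ennreal (p z))"
    and "prob_space (convolution \<mu> (gaussian_measure \<delta>))"
proof -
  interpret \<mu>: prob_space \<mu> by fact
  interpret \<gamma>: prob_space "gaussian_measure \<delta> :: (real ^ 'n) measure"
    by (rule prob_space_gaussian_measure) fact
  interpret pair_sigma_finite \<mu> "lborel :: (real ^ 'n) measure" ..
  define e where "e z = (2 * pi * \<delta>) powr (- (real CARD('n) / 2)) * exp (- (norm z)\<^sup>2 / (2 * \<delta>))" for z :: "real ^ 'n"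
  have [measurable]: "e \<in> borel_measurable borel" unfolding e_def by measurable
  have e_pos: "0 \<le> e z" for z by (simp add: e_def)
  have p: "p = (\<lambda>z. \<integral>\<xi>. e (z - \<xi>) \<partial>\<mu>)" unfolding p_def e_def ..
  show m[measurable]: "p \<in> borel_measurable borel" unfolding p by measurable
  have e_int: "integrable \<mu> (\<lambda>\<xi>. e (z - \<xi>))" for z
    by (rule \<mu>.integrable_const_bound[where B = "(2 * pi * \<delta>) powr (- (real CARD('n) / 2))"])
      (use \<delta> in \<open>auto simp: e_def mult_le_cancel_left2\<close>)
  have pe: "ennreal (p z) = (\<integral>\<^sup>+\<xi>. ennreal (e (z - \<xi>)) \<partial>\<mu>)" for z
    unfolding p using e_int e_pos by (intro nn_integral_eq_integral[symmetric]) auto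
  have g: "gaussian_measure \<delta> = density lborel (\<lambda>z. ennreal (e z))"
    unfolding gaussian_measure_def e_def ..
  have sg[measurable_cong]: "sets (gaussian_measure \<delta>) = sets (borel :: (real ^ 'n) measure)"
    by (simp add: gaussian_measure_def)
  show "prob_space (convolution \<mu> (gaussian_measure \<delta>))"
  proof -
    interpret P: pair_prob_space \<mu> "gaussian_measure \<delta> :: (real ^ 'n) measure" ..
    show ?thesis unfolding convolution_def by (intro P.prob_space_distr) measurable
  qed
  show "convolution \<mu> (gaussian_measure \<delta>) = density lborel (\<lambda>z. ennreal (p z))"
  proof (rule measure_eqI)
    fix A assume "A \<in> sets (convolution \<mu> (gaussian_measure \<delta>))"
    then have [measurable]: "A \<in> sets borel" by simp
    have "emeasure (convolution \<mu> (gaussian_measure \<delta>)) A = (\<integral>\<^sup>+z. indicator A z \<partial>convolution \<mu> (gaussian_measure \<delta>))"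
      by simp
    also have "\<dots> = (\<integral>\<^sup>+\<xi>. \<integral>\<^sup>+y. indicator A (\<xi> + y) \<partial>gaussian_measure \<delta> \<partial>\<mu>)"
      by (rule nn_integral_convolution[OF \<mu>.finite_measure_axioms \<gamma>.finite_measure_axioms sg sets]) simp
    also have "\<dots> = (\<integral>\<^sup>+\<xi>. \<integral>\<^sup>+z. ennreal (e (z - \<xi>)) * indicator A z \<partial>lborel \<partial>\<mu>)"
    proof (intro nn_integral_cong)
      fix \<xi>
      have "(\<integral>\<^sup>+y. indicator A (\<xi> + y) \<partial>gaussian_measure \<delta>) = (\<integral>\<^sup>+y. ennreal (e y) * indicator A (\<xi> + y) \<partial>lborel)"
        unfolding g by (subst nn_integral_density) auto
      also have "\<dots> = (\<integral>\<^sup>+z. ennreal (e (z - \<xi>)) * indicator A z \<partial>distr lborel borel ((+) \<xi>))"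
        by (subst nn_integral_distr) auto
      finally show "(\<integral>\<^sup>+y. indicator A (\<xi> + y) \<partial>gaussian_measure \<delta>) = (\<integral>\<^sup>+z. ennreal (e (z - \<xi>)) * indicator A z \<partial>lborel)"
        by (simp add: lborel_distr_plus)
    qed
    also have "\<dots> = (\<integral>\<^sup>+z. \<integral>\<^sup>+\<xi>. ennreal (e (z - \<xi>)) * indicator A z \<partial>\<mu> \<partial>lborel)"
      by (rule Fubini'[symmetric]) measurable
    also have "\<dots> = emeasure (density lborel (\<lambda>z. ennreal (p z))) A"
      by (simp add: emeasure_density pe nn_integral_multc)
    finally show "emeasure (convolution \<mu> (gaussian_measure \<delta>)) A = emeasure (density lborel (\<lambda>z. ennreal (p z))) A" .
  qed simp
qed

lemma AE_measure_support:
  fixes M :: "'a::second_countable_topology measure"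
  assumes "sets M = sets borel"
  shows "AE x in M. x \<in> measure_support M"
proof -
  obtain \<B> :: "'a set set" where \<B>: "countable \<B>" "topological_basis \<B>"
    using ex_countable_basis by blast
  define N where "N = {U\<in>\<B>. emeasure M U = 0}"
  have "\<Union>N \<in> null_sets M"
    using \<B> assms null_sets_UN'[of N "\<lambda>U. U" M]
    by (auto simp: N_def null_sets_def topological_basis_open intro: countable_subset)
  moreover have "- measure_support M \<subseteq> \<Union>N"
  proof
    fix x assume "x \<in> - measure_support M"
    then obtain U where U: "open U" "x \<in> U" "emeasure M U = 0"
      by (auto simp: measure_support_def)
    then obtain V where V: "V \<in> \<B>" "x \<in> V" "V \<subseteq> U"
      using \<B>(2) by (meson topological_basisE)
    then have "emeasure M V = 0"
      using emeasure_mono[of V U M] U assms by auto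
    then show "x \<in> \<Union>N" using V by (auto simp: N_def)
  qed
  ultimately show ?thesis
    by (intro AE_I'[of "\<Union>N"]) auto
qed

section \<open>From Prekopa--Leindler to an entropy bound\<close>

text \<open>Both sides of the hypothesis equal \<open>m\<close> at \<open>s = 0\<close>. Comparing their derivatives there, \<open>e\<close> on the left
and \<open>q + m * ln m\<close> on the right, gives the claim.\<close>

lemma entropy_le_of_power_means:
  fixes m e q s\<^sub>0 :: real
  assumes m: "0 < m" and s\<^sub>0: "0 < s\<^sub>0"
    and le: "\<And>s. 0 < s \<Longrightarrow> s \<le> s\<^sub>0 \<Longrightarrow> s < 1 \<Longrightarrow> m + s / (1 - s) * e \<le> (m + s * q) powr (1 / (1 - s))"
  shows "e - m * ln m \<le> q"
proof (rule ccontr)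
  assume "\<not> e - m * ln m \<le> q"
  then have neg: "q + m * ln m - e < 0" by simp
  define F where "F s = (m + s * q) powr (1 / (1 - s)) - (m + s / (1 - s) * e)" for s
  have "DERIV F 0 :> q + m * ln m - e"
  proof -
    have "DERIV (\<lambda>s. m + s * q) 0 :> q" "DERIV (\<lambda>s. 1 / (1 - s)) 0 :> (1::real)"
      "DERIV (\<lambda>s. m + s / (1 - s) * e) 0 :> e"
      by (auto intro!: derivative_eq_intros)
    then have "DERIV F 0 :> ((m + 0 * q) powr (1 / (1 - 0)) * (1 * ln (m + 0 * q) + q * (1 / (1 - 0)) / (m + 0 * q))) - e"
      unfolding F_def using m by (intro DERIV_diff DERIV_powr) auto
    then show ?thesis using m by (simp add: distrib_left algebra_simps)
  qed
  from DERIV_neg_dec_right[OF this neg] obtain d where d: "d > 0" "\<And>h. 0 < h \<Longrightarrow> h < d \<Longrightarrow> F h < F 0"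
    by auto
  define h where "h = min (d / 2) (min s\<^sub>0 (1 / 2))"
  have h: "0 < h" "h < d" "h \<le> s\<^sub>0" "h < 1" using d(1) s\<^sub>0 by (auto simp: h_def)
  have "F 0 = 0" using m by (simp add: F_def)
  then show False using d(2)[OF h(1,2)] le[OF h(1,3,4)] by (simp add: F_def)
qed

text \<open>The argument of Bobkov and Ledoux. Prekopa--Leindler is applied to \<open>\<phi>\<^sup>1\<^sup>/\<^sup>t p\<close> and \<open>p\<close> with \<open>t = 1 - s\<close> close
to 1. The strong log-concavity of \<open>p\<close> gains a factor \<open>exp (- (c / 2) t s |d|\<^sup>2)\<close>, where \<open>d\<close> is the
difference of the two points, while moving \<open>\<phi>\<close> from \<open>z + s d\<close> to \<open>z\<close> costs about \<open>s (G z \<bullet> d)\<close>. Optimising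
over \<open>d\<close> leaves a cost of order \<open>s |G z|\<^sup>2 / (c \<phi> z)\<close>, so \<open>\<phi> + s Q\<close> may serve as the third function. Letting
\<open>s\<close> tend to 0 turns the resulting comparison of power means into the entropy bound. The
semiconcavity constant \<open>M\<close> enters only at order \<open>s\<^sup>2\<close> and so does not appear in the result.\<close>

theorem entropy_le_energy_of_semiconcave:
  fixes p \<phi> :: "'a::euclidean_space \<Rightarrow> real" and G :: "'a \<Rightarrow> 'a"
  assumes p[measurable]: "p \<in> borel_measurable borel" and p0: "\<And>x. 0 \<le> p x"
    and prob: "prob_space (density lborel (\<lambda>x. ennreal (p x)))"
    and slc: "strongly_log_concave c p" and c: "0 < c"
    and \<phi>[measurable]: "\<phi> \<in> borel_measurable borel" and \<epsilon>: "0 < \<epsilon>" and \<phi>_ge: "\<And>x. \<epsilon> \<le> \<phi> x" and \<phi>_le: "\<And>x. \<phi> x \<le> B"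
    and G[measurable]: "G \<in> borel_measurable borel" and GL: "\<And>x. norm (G x) \<le> L"
    and M: "0 \<le> M" and semi: "\<And>z v. \<phi> (z + v) \<le> \<phi> z + G z \<bullet> v + M * (norm v)\<^sup>2"
  shows "Ent (density lborel (\<lambda>x. ennreal (p x))) \<phi> \<le>
    2 / c * (\<integral>x. (norm (G x))\<^sup>2 / \<phi> x \<partial>density lborel (\<lambda>x. ennreal (p x)))"
proof -
  define \<nu> where "\<nu> = density lborel (\<lambda>x. ennreal (p x))"
  interpret \<nu>: prob_space \<nu> unfolding \<nu>_def by (rule prob)
  have sets[measurable_cong]: "sets \<nu> = sets borel" by (simp add: \<nu>_def)
  have nn: "(\<integral>\<^sup>+x. ennreal (f x * p x) \<partial>lborel) = (\<integral>\<^sup>+x. ennreal (f x) \<partial>\<nu>)"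
    if [measurable]: "f \<in> borel_measurable borel" and "\<And>x. 0 \<le> f x" for f :: "'a \<Rightarrow> real"
    unfolding \<nu>_def using that(2) p0
    by (subst nn_integral_density) (auto simp: ennreal_mult mult.commute intro!: nn_integral_cong)
  have \<phi>0: "0 < \<phi> x" for x using \<epsilon> \<phi>_ge[of x] by linarith
  define Q where "Q x = 2 / c * ((norm (G x))\<^sup>2 / \<phi> x)" for x
  have [measurable]: "Q \<in> borel_measurable borel" unfolding Q_def by measurable
  have Q0: "0 \<le> Q x" for x using c \<phi>0[of x] by (simp add: Q_def)
  have L: "0 \<le> L" using GL[of undefined] norm_ge_zero[of "G undefined"] by linarith
  have QB: "Q x \<le> 2 / c * (L\<^sup>2 / \<epsilon>)" for x
    unfolding Q_def using c \<epsilon> \<phi>_ge[of x] GL[of x]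
    by (intro mult_left_mono frac_le power_mono) auto
  have int_bd: "integrable \<nu> f" if [measurable]: "f \<in> borel_measurable borel" and "\<And>x. \<bar>f x\<bar> \<le> C" for f :: "'a \<Rightarrow> real" and C :: real
    by (rule \<nu>.integrable_const_bound[where B = C]) (use that in auto)
  have Q_int: "integrable \<nu> Q" by (rule int_bd) (use Q0 QB in auto)
  have \<phi>_int: "integrable \<nu> \<phi>" by (rule int_bd) (use \<phi>0 \<phi>_le in \<open>auto simp: less_imp_le\<close>)
  have ln_bd: "\<bar>ln (\<phi> x)\<bar> \<le> max \<bar>ln \<epsilon>\<bar> \<bar>ln B\<bar>" for x
  proof -
    have "ln \<epsilon> \<le> ln (\<phi> x)" "ln (\<phi> x) \<le> ln B" using \<phi>_ge[of x] \<phi>_le[of x] \<epsilon> \<phi>0[of x] by auto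
    then show ?thesis by linarith
  qed
  have e_int: "integrable \<nu> (\<lambda>x. \<phi> x * ln (\<phi> x))"
    by (rule int_bd[of _ "B * max \<bar>ln \<epsilon>\<bar> \<bar>ln B\<bar>"])
      (use \<phi>0 \<phi>_le ln_bd in \<open>auto simp: abs_mult less_imp_le intro!: mult_mono\<close>, meson less_imp_le order.trans)
  define m where "m = (\<integral>x. \<phi> x \<partial>\<nu>)"
  define e where "e = (\<integral>x. \<phi> x * ln (\<phi> x) \<partial>\<nu>)"
  define q where "q = (\<integral>x. Q x \<partial>\<nu>)"
  have "\<epsilon> \<le> m" unfolding m_def using \<nu>.integral_ge_const[OF \<phi>_int] \<phi>_ge by auto
  then have m: "0 < m" using \<epsilon> by linarith
  have q: "0 \<le> q" unfolding q_def using Q0 by (intro Bochner_Integration.integral_nonneg)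
  \<comment> \<open>The first bound leaves \<open>c / 4\<close> of the convexity gain after the second-order term with \<open>M\<close>; the
    second keeps the exponent at most 1, so that the exponential may be linearised.\<close>
  define s\<^sub>0 where "s\<^sub>0 = min (c / (2 * (c + 2 * (M / \<epsilon>)))) (c / (L\<^sup>2 / \<epsilon>\<^sup>2 + 1))"
  have "0 < c + 2 * (M / \<epsilon>)" "0 < L\<^sup>2 / \<epsilon>\<^sup>2 + 1"
    using c \<epsilon> M by (intro add_pos_nonneg add_nonneg_pos; simp)+
  then have s\<^sub>0: "0 < s\<^sub>0" using c by (simp add: s\<^sub>0_def)
  have "m + s / (1 - s) * e \<le> (m + s * q) powr (1 / (1 - s))" if s: "0 < s" "s \<le> s\<^sub>0" "s < 1" for s
  proof -
    define t where "t = 1 - s"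
    have t: "0 < t" "t < 1" and s_eq: "s = 1 - t" using s by (auto simp: t_def)
    have sM: "s * (M / \<epsilon>) - c / 2 * t \<le> - (c / 4)"
    proof -
      have "s * (2 * (c + 2 * (M / \<epsilon>))) \<le> c"
        using s(2) c M \<epsilon> unfolding s\<^sub>0_def by (simp add: pos_le_divide_eq add_pos_nonneg)
      moreover have "s * k - c / 2 * (1 - s) \<le> - (c / 4)" if "s * (2 * (c + 2 * k)) \<le> c" for k
        using that by (simp add: algebra_simps)
      ultimately show ?thesis unfolding t_def by blast
    qed
    have sX: "s * ((norm (G z))\<^sup>2 / (\<phi> z)\<^sup>2) / c \<le> 1" for z
    proof -
      have "(norm (G z))\<^sup>2 / (\<phi> z)\<^sup>2 \<le> L\<^sup>2 / \<epsilon>\<^sup>2"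
        using GL[of z] \<phi>_ge[of z] \<epsilon> by (intro frac_le power_mono) auto
      moreover have "s * (L\<^sup>2 / \<epsilon>\<^sup>2 + 1) \<le> c"
        using s(2) c unfolding s\<^sub>0_def by (simp add: pos_le_divide_eq add_nonneg_pos)
      ultimately have "s * ((norm (G z))\<^sup>2 / (\<phi> z)\<^sup>2) \<le> c"
        using s(1) by (smt (verit) mult_left_mono)
      then show ?thesis using c by (subst divide_le_eq_1_pos)
    qed
    have pt: "\<phi> (z + s *\<^sub>R d) * exp (- (c / 2) * (t * s) * (norm d)\<^sup>2) \<le> \<phi> z + s * Q z" for z d
    proof -
      define a where "a = norm (G z) / \<phi> z"
      define b where "b = norm d"
      have ab: "0 \<le> a" "0 \<le> b" using \<phi>0[of z] by (auto simp: a_def b_def)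
      have "\<phi> (z + s *\<^sub>R d) \<le> \<phi> z + s * (norm (G z) * b) + M * (s\<^sup>2 * b\<^sup>2)"
        using semi[of z "s *\<^sub>R d"] s norm_cauchy_schwarz[of "G z" d]
        by (simp add: b_def power_mult_distrib) (smt (verit) mult_left_mono)
      also have "\<dots> = \<phi> z * (1 + (s * (a * b) + M / \<phi> z * (s\<^sup>2 * b\<^sup>2)))"
        using \<phi>0[of z] by (simp add: a_def field_simps)
      also have "\<dots> \<le> \<phi> z * exp (s * (a * b) + M / \<phi> z * (s\<^sup>2 * b\<^sup>2))"
        using \<phi>0[of z] by (intro mult_left_mono exp_ge_add_one_self) (auto simp: less_imp_le)
      also have "\<dots> \<le> \<phi> z * exp (s * (a * b) + M / \<epsilon> * (s\<^sup>2 * b\<^sup>2))"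
        using \<phi>0[of z] \<phi>_ge[of z] \<epsilon> M by (auto simp: less_imp_le intro!: mult_left_mono mult_right_mono divide_left_mono)
      finally have "\<phi> (z + s *\<^sub>R d) * exp (- (c / 2) * (t * s) * b\<^sup>2) \<le>
          \<phi> z * exp (s * (a * b) + M / \<epsilon> * (s\<^sup>2 * b\<^sup>2)) * exp (- (c / 2) * (t * s) * b\<^sup>2)"
        by (rule mult_right_mono) simp
      also have "\<dots> = \<phi> z * exp (s * (a * b) + s * (s * (M / \<epsilon>) - c / 2 * t) * b\<^sup>2)"
        unfolding mult.assoc exp_add[symmetric] by (simp add: algebra_simps power2_eq_square)
      also have "\<dots> \<le> \<phi> z * exp (s * a\<^sup>2 / c)"
      proof -
        have "s * (s * (M / \<epsilon>) - c / 2 * t) * b\<^sup>2 \<le> s * (- (c / 4)) * b\<^sup>2"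
          using sM s by (intro mult_right_mono mult_left_mono) auto
        \<comment> \<open>completing the square in \<open>b\<close>, the maximiser being \<open>b = 2 * a / c\<close>\<close>
        moreover have "s * (a * b) + s * (- (c / 4)) * b\<^sup>2 \<le> s * a\<^sup>2 / c"
        proof -
          have "0 \<le> s * ((a - c / 2 * b)\<^sup>2 / c)" using s c by simp
          also have "\<dots> = s * a\<^sup>2 / c - (s * (a * b) + s * (- (c / 4)) * b\<^sup>2)"
            using c by (simp add: field_simps power2_eq_square)
          finally show ?thesis by simp
        qed
        ultimately show ?thesis using \<phi>0[of z] by (intro mult_left_mono) (auto simp: less_imp_le)
      qed
      also have "\<dots> \<le> \<phi> z * (1 + 2 * (s * a\<^sup>2 / c))"
      proof -
        have x: "0 \<le> s * a\<^sup>2 / c" "s * a\<^sup>2 / c \<le> 1"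
          using s c sX[of z] by (auto simp: a_def power_divide)
        have "exp y \<le> 1 + 2 * y" if "0 \<le> y" "y \<le> 1" for y :: real
        proof -
          have "y\<^sup>2 \<le> y" using that by (simp add: power2_eq_square mult_left_le)
          then show ?thesis using exp_bound[OF that] by linarith
        qed
        note this[OF x]
        then show ?thesis using \<phi>0[of z] by (intro mult_left_mono) (auto simp: less_imp_le)
      qed
      also have "\<dots> = \<phi> z + s * Q z"
        using \<phi>0[of z] by (simp add: Q_def a_def field_simps power2_eq_square)
      finally show ?thesis unfolding b_def .
    qed
    define \<psi> where "\<psi> x = \<phi> x powr (1 / t)" for x
    have [measurable]: "\<psi> \<in> borel_measurable borel" unfolding \<psi>_def by measurable
    have \<psi>0: "0 \<le> \<psi> x" for x by (simp add: \<psi>_def)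
    have \<psi>_int: "integrable \<nu> \<psi>"
      by (rule int_bd[of _ "B powr (1 / t)"])
        (use \<phi>0 \<phi>_le t in \<open>auto simp: \<psi>_def less_imp_le intro!: powr_mono2\<close>)
    have "geometric_mean_le t (\<integral>\<^sup>+x. ennreal (\<psi> x * p x) \<partial>lborel) (\<integral>\<^sup>+x. ennreal (1 * p x) \<partial>lborel)
      (\<integral>\<^sup>+x. ennreal ((\<phi> x + s * Q x) * p x) \<partial>lborel)"
    proof (rule prekopa_leindler)
      fix x y :: 'a
      define z where "z = t *\<^sub>R x + (1 - t) *\<^sub>R y"
      have x: "x = z + s *\<^sub>R (x - y)" unfolding z_def s_eq by (simp add: algebra_simps)
      have "(\<psi> x * p x) powr t * (1 * p y) powr (1 - t) = \<phi> x * (p x powr t * p y powr (1 - t))"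
        using \<phi>0[of x] p0[of x] p0[of y] t by (simp add: \<psi>_def powr_mult powr_powr)
      also have "\<dots> \<le> \<phi> x * (p z * exp (- (c / 2) * (t * (1 - t)) * (norm (x - y))\<^sup>2))"
        using slc t \<phi>0[of x] unfolding strongly_log_concave_def z_def
        by (intro mult_left_mono) (auto simp: less_imp_le)
      also have "\<dots> = \<phi> (z + s *\<^sub>R (x - y)) * exp (- (c / 2) * (t * s) * (norm (x - y))\<^sup>2) * p z"
        using x s_eq by simp
      also have "\<dots> \<le> (\<phi> z + s * Q z) * p z"
        by (intro mult_right_mono pt p0)
      finally show "geometric_mean_le t (ennreal (\<psi> x * p x)) (ennreal (1 * p y))
          (ennreal ((\<phi> (t *\<^sub>R x + (1 - t) *\<^sub>R y) + s * Q (t *\<^sub>R x + (1 - t) *\<^sub>R y)) * p (t *\<^sub>R x + (1 - t) *\<^sub>R y)))"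
        unfolding z_def[symmetric] using t p0 \<psi>0 by (intro geometric_mean_le_ennreal) auto
    qed (use t in measurable)
    also have "(\<integral>\<^sup>+x. ennreal (\<psi> x * p x) \<partial>lborel) = ennreal (\<integral>x. \<psi> x \<partial>\<nu>)"
      using \<psi>0 \<psi>_int by (simp add: nn nn_integral_eq_integral)
    also have "(\<integral>\<^sup>+x. ennreal (1 * p x) \<partial>lborel) = ennreal 1"
      by (subst nn) (auto simp: \<nu>.emeasure_space_1)
    also have "(\<integral>\<^sup>+x. ennreal ((\<phi> x + s * Q x) * p x) \<partial>lborel) = ennreal (m + s * q)"
    proof -
      have "(\<integral>\<^sup>+x. ennreal (\<phi> x + s * Q x) \<partial>\<nu>) = ennreal (\<integral>x. \<phi> x + s * Q x \<partial>\<nu>)"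
        using s \<phi>0 Q0 \<phi>_int Q_int by (intro nn_integral_eq_integral) (auto simp: less_imp_le)
      also have "(\<integral>x. \<phi> x + s * Q x \<partial>\<nu>) = m + s * q"
        unfolding m_def q_def using \<phi>_int Q_int by simp
      finally show ?thesis
        using s \<phi>0 Q0 by (subst nn) (auto simp: less_imp_le)
    qed
    finally have "geometric_mean_le t (ennreal (\<integral>x. \<psi> x \<partial>\<nu>)) (ennreal 1) (ennreal (m + s * q))" .
    moreover have "0 \<le> (\<integral>x. \<psi> x \<partial>\<nu>)" using \<psi>0 by (intro Bochner_Integration.integral_nonneg)
    ultimately have "ennreal ((\<integral>x. \<psi> x \<partial>\<nu>) powr t * 1 powr (1 - t)) \<le> ennreal (m + s * q)"
      unfolding geometric_mean_le_def by (meson order_refl zero_le_one)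
    then have "(\<integral>x. \<psi> x \<partial>\<nu>) powr t \<le> m + s * q"
      using m q s by (simp del: ennreal_plus)
    then have "((\<integral>x. \<psi> x \<partial>\<nu>) powr t) powr (1 / t) \<le> (m + s * q) powr (1 / t)"
      using t by (intro powr_mono2) auto
    then have "(\<integral>x. \<psi> x \<partial>\<nu>) \<le> (m + s * q) powr (1 / t)"
      using t \<psi>0 by (simp add: powr_powr Bochner_Integration.integral_nonneg)
    moreover have "m + s / t * e \<le> (\<integral>x. \<psi> x \<partial>\<nu>)"
    proof -
      have "m + s / t * e = (\<integral>x. \<phi> x + s / t * (\<phi> x * ln (\<phi> x)) \<partial>\<nu>)"
        unfolding m_def e_def using \<phi>_int e_int by simp
      also have "\<dots> \<le> (\<integral>x. \<psi> x \<partial>\<nu>)"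
      proof (rule integral_mono)
        fix x
        have "1 / t = 1 + s / t" using t by (simp add: s_eq field_simps)
        then have "\<psi> x = \<phi> x * exp (s / t * ln (\<phi> x))"
          using \<phi>0[of x] by (simp add: \<psi>_def powr_def exp_add distrib_right)
        also have "\<dots> \<ge> \<phi> x * (1 + s / t * ln (\<phi> x))"
          using \<phi>0[of x] by (intro mult_left_mono exp_ge_add_one_self) (auto simp: less_imp_le)
        finally show "\<phi> x + s / t * (\<phi> x * ln (\<phi> x)) \<le> \<psi> x" by (simp add: algebra_simps)
      qed (use \<phi>_int e_int \<psi>_int in auto)
      finally show ?thesis .
    qed
    ultimately show ?thesis unfolding t_def by linarith
  qed
  from entropy_le_of_power_means[OF m s\<^sub>0 this]
  show ?thesis
    unfolding Ent_def \<nu>_def[symmetric] m_def e_def q_def Q_def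
    by (simp only: Bochner_Integration.integral_mult_right_zero)
qed

section \<open>Differential calculus, and cutoff functions\<close>

lemma GDERIV_gradient:
  fixes f :: "'a::euclidean_space \<Rightarrow> real"
  assumes "f differentiable (at x)"
  shows "GDERIV f x :> gradient f x" and "frechet_derivative f (at x) v = v \<bullet> gradient f x"
proof -
  let ?D = "frechet_derivative f (at x)"
  have D: "(f has_derivative ?D) (at x)" using assms by (simp add: frechet_derivative_works)
  define G where "G = (\<Sum>b\<in>Basis. ?D b *\<^sub>R b)"
  have DG: "?D v = v \<bullet> G" for v
  proof -
    have "?D v = ?D (\<Sum>b\<in>Basis. (v \<bullet> b) *\<^sub>R b)" by (simp add: euclidean_representation)
    also have "\<dots> = v \<bullet> G"
      using linear_frechet_derivative[OF assms]
      by (simp add: linear_sum linear_cmul G_def inner_sum_right mult.commute)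
    finally show ?thesis .
  qed
  then have "?D = (\<lambda>h. h \<bullet> G)" by auto
  with D have G: "GDERIV f x :> G" by (simp add: gderiv_def)
  then have "gradient f x = G" by (rule gradient_eqI)
  then show "GDERIV f x :> gradient f x" "frechet_derivative f (at x) v = v \<bullet> gradient f x"
    using G DG by auto
qed

lemma Ck_Suc_imp_Ck: "Ck (Suc k) f \<Longrightarrow> Ck k f"
proof (induction k arbitrary: f)
  case 0
  then show ?case
    by (auto simp: continuous_on_eq_continuous_within intro: differentiable_imp_continuous_within)
next
  case (Suc k)
  then show ?case by (metis Ck.simps(2))
qed

lemma Ck_const: "Ck k (\<lambda>x. c)"
  by (induction k arbitrary: c) (auto simp: frechet_derivative_const)

lemma Ck_add:
  fixes f g :: "'a::real_normed_vector \<Rightarrow> 'b::real_normed_vector"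
  shows "Ck k f \<Longrightarrow> Ck k g \<Longrightarrow> Ck k (\<lambda>x. f x + g x)"
proof (induction k arbitrary: f g)
  case (Suc k)
  have "frechet_derivative (\<lambda>x. f x + g x) (at x) = (\<lambda>v. frechet_derivative f (at x) v + frechet_derivative g (at x) v)" for x
    using Suc.prems by (intro frechet_derivative_at[symmetric] has_derivative_add) (auto simp: frechet_derivative_works)
  then show ?case using Suc by (auto intro!: differentiable_add)
qed (auto intro: continuous_on_add)

lemma Ck_mult:
  fixes f g :: "'a::real_normed_vector \<Rightarrow> real"
  shows "Ck k f \<Longrightarrow> Ck k g \<Longrightarrow> Ck k (\<lambda>x. f x * g x)"
proof (induction k arbitrary: f g)
  case (Suc k)
  have "frechet_derivative (\<lambda>x. f x * g x) (at x) =
      (\<lambda>v. f x * frechet_derivative g (at x) v + frechet_derivative f (at x) v * g x)" for x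
    using Suc.prems by (intro frechet_derivative_at[symmetric] has_derivative_mult) (auto simp: frechet_derivative_works)
  moreover have "Ck k f" "Ck k g" using Suc.prems by (auto intro: Ck_Suc_imp_Ck)
  ultimately show ?case using Suc by (auto intro!: differentiable_mult Ck_add)
qed (auto intro: continuous_on_mult)

lemma Ck_inner_const:
  fixes v :: "'a::real_inner"
  shows "Ck k (\<lambda>x. x \<bullet> v)"
proof (cases k)
  case (Suc j)
  have "frechet_derivative (\<lambda>x. x \<bullet> v) (at x) = (\<lambda>h. h \<bullet> v)" for x :: 'a
    by (intro frechet_derivative_at[symmetric] derivative_intros)
  then show ?thesis using Suc by (auto simp: Ck_const intro!: differentiable_inner)
qed (auto intro!: continuous_intros)

text \<open>The powers of the positive part of a function are the source of cutoff functions: each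
exponent above 1 adds one order of differentiability, so no bump function of class
\<open>C\<^sup>\<infinity>\<close> has to be built.\<close>

lemma DERIV_max_power:
  "((\<lambda>r::real. max 0 r ^ Suc (Suc n)) has_real_derivative real (Suc (Suc n)) * max 0 r ^ Suc n) (at r)"
proof -
  consider "r < 0" | "r = 0" | "r > 0" by linarith
  then show ?thesis
  proof cases
    case 1
    have "((\<lambda>r::real. 0) has_real_derivative 0) (at r)" by simp
    then have "((\<lambda>r::real. max 0 r ^ Suc (Suc n)) has_real_derivative 0) (at r)"
      by (rule has_field_derivative_transform_within_open[where S = "{..<0}"]) (use 1 in auto)
    then show ?thesis using 1 by simp
  next
    case 2
    have "((\<lambda>h. (max 0 (0 + h) ^ Suc (Suc n) - max 0 0 ^ Suc (Suc n)) / h) \<longlongrightarrow> 0) (at (0::real))"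
    proof (rule Lim_null_comparison)
      show "eventually (\<lambda>h. norm ((max 0 (0 + h) ^ Suc (Suc n) - max 0 0 ^ Suc (Suc n)) / h) \<le> \<bar>h\<bar> ^ Suc n) (at (0::real))"
      proof (intro always_eventually allI)
        fix h :: real
        show "norm ((max 0 (0 + h) ^ Suc (Suc n) - max 0 0 ^ Suc (Suc n)) / h) \<le> \<bar>h\<bar> ^ Suc n"
          by (cases "h \<le> 0") (simp_all add: max_absorb1 max_absorb2 abs_mult mult_nonpos_nonneg)
      qed
      show "((\<lambda>h. \<bar>h\<bar> ^ Suc n) \<longlongrightarrow> 0) (at (0::real))"
        by (auto intro!: tendsto_eq_intros)
    qed
    then show ?thesis using 2 by (simp add: DERIV_def)
  next
    case 3
    have "((\<lambda>r::real. r ^ Suc (Suc n)) has_real_derivative real (Suc (Suc n)) * r ^ Suc n) (at r)"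
      using DERIV_pow[of "Suc (Suc n)" r] by (simp del: power_Suc of_nat_Suc)
    then have "((\<lambda>r::real. max 0 r ^ Suc (Suc n)) has_real_derivative real (Suc (Suc n)) * r ^ Suc n) (at r)"
      by (rule has_field_derivative_transform_within_open[where S = "{0<..}"]) (use 3 in auto)
    then show ?thesis using 3 by (simp add: max_def)
  qed
qed

lemma Ck_max_power:
  fixes q :: "'a::real_normed_vector \<Rightarrow> real"
  assumes q: "\<And>k. Ck k q"
  shows "Ck k (\<lambda>x. max 0 (q x) ^ Suc k)"
proof (induction k)
  case 0
  then show ?case using q[of 0] by (auto intro!: continuous_intros)
next
  case (Suc k)
  have qd: "(q has_derivative frechet_derivative q (at x)) (at x)" for x
    using q[of 1] by (simp add: frechet_derivative_works)
  have D: "((\<lambda>x. max 0 (q x) ^ Suc (Suc k)) has_derivative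
      (\<lambda>v. frechet_derivative q (at x) v * (real (Suc (Suc k)) * max 0 (q x) ^ Suc k))) (at x)" for x
    by (rule DERIV_compose_FDERIV[OF DERIV_max_power qd])
  have "frechet_derivative (\<lambda>x. max 0 (q x) ^ Suc (Suc k)) (at x) =
      (\<lambda>v. frechet_derivative q (at x) v * (real (Suc (Suc k)) * max 0 (q x) ^ Suc k))" for x
    by (rule frechet_derivative_at[symmetric, OF D])
  moreover have "Ck k (\<lambda>x. frechet_derivative q (at x) v)" for v
    using q[of "Suc k"] by simp
  moreover have "(\<lambda>x. max 0 (q x) ^ Suc (Suc k)) differentiable (at x)" for x
    using D unfolding differentiable_def by blast
  ultimately show ?case
    using Suc.IH by (simp del: power_Suc add: Ck_mult Ck_const)
qed

text \<open>The exponent 3 makes the cutoff twice continuously differentiable, which is what the bounds on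
second derivatives below require.\<close>

definition cutoff :: "real \<Rightarrow> 'a::real_inner \<Rightarrow> real" where
  "cutoff r x = max 0 (1 - (x \<bullet> x) / r\<^sup>2) ^ 3"

lemma cutoff_bounds: "0 \<le> cutoff r x" "cutoff r x \<le> 1"
  by (auto simp: cutoff_def intro!: power_le_one)

lemma cutoff_eq_0:
  assumes "0 < r" "r \<le> norm x"
  shows "cutoff r x = 0"
proof -
  have "r\<^sup>2 \<le> x \<bullet> x" using assms by (simp flip: power2_norm_eq_inner)
  then show ?thesis using assms by (simp add: cutoff_def max_def)
qed

lemma cutoff_tendsto_1: "(\<lambda>k. cutoff (real (Suc k)) x) \<longlonglongrightarrow> 1"
proof -
  have "(\<lambda>k. inverse (real (Suc k))) \<longlonglongrightarrow> 0" by (rule LIMSEQ_inverse_real_of_nat)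
  then have "(\<lambda>k. max 0 (1 - (x \<bullet> x) * (inverse (real (Suc k)))\<^sup>2) ^ 3) \<longlonglongrightarrow> max 0 (1 - (x \<bullet> x) * 0\<^sup>2) ^ 3"
    by (intro tendsto_intros)
  then show ?thesis by (simp add: cutoff_def divide_inverse power_inverse)
qed

lemma Ck_cutoff: "Ck 2 (cutoff r :: 'a::euclidean_space \<Rightarrow> real)"
proof -
  have "Ck k (\<lambda>x::'a. \<Sum>b\<in>B. (x \<bullet> b) * (x \<bullet> b))" if "finite B" for k B
    using that
  proof (induction B)
    case (insert b B)
    then have "Ck k (\<lambda>x. (x \<bullet> b) * (x \<bullet> b) + (\<Sum>b\<in>B. (x \<bullet> b) * (x \<bullet> b)))"
      by (intro Ck_add Ck_mult Ck_inner_const)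
    then show ?case using insert.hyps by simp
  qed (simp add: Ck_const)
  then have "Ck k (\<lambda>x::'a. x \<bullet> x)" for k
    by (subst euclidean_inner) simp
  then have "Ck k (\<lambda>x::'a. 1 + (- inverse (r\<^sup>2)) * (x \<bullet> x))" for k
    by (intro Ck_add Ck_mult Ck_const)
  from Ck_max_power[OF this, of 2] show ?thesis
    by (simp add: cutoff_def[abs_def] divide_inverse numeral_3_eq_3 mult.commute)
qed

lemma GDERIV_cutoff:
  "GDERIV (cutoff r) x :> (- 6 / r\<^sup>2 * (max 0 (1 - (x \<bullet> x) / r\<^sup>2))\<^sup>2) *\<^sub>R x"
proof -
  have "((\<lambda>x. 1 - (x \<bullet> x) * c) has_derivative (\<lambda>h. - (2 * (h \<bullet> x) * c))) (at x)" for c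
    by (auto intro!: derivative_eq_intros simp: inner_commute)
  from this[of "inverse (r\<^sup>2)"]
  have "((\<lambda>x. 1 - (x \<bullet> x) / r\<^sup>2) has_derivative (\<lambda>h. - (2 * (h \<bullet> x) / r\<^sup>2))) (at x)"
    by (simp add: divide_inverse)
  from DERIV_compose_FDERIV[OF DERIV_max_power[of 1] this] show ?thesis
    unfolding gderiv_def cutoff_def
    by (simp add: numeral_3_eq_3 numeral_2_eq_2 algebra_simps)
qed

lemma norm_gradient_cutoff:
  assumes r: "0 < r"
  shows "norm (gradient (cutoff r) x) \<le> 6 / r"
proof -
  have eq: "gradient (cutoff r) x = (- 6 / r\<^sup>2 * (max 0 (1 - (x \<bullet> x) / r\<^sup>2))\<^sup>2) *\<^sub>R x"
    by (rule gradient_eqI) (rule GDERIV_cutoff)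
  show ?thesis
  proof (cases "norm x \<le> r")
    case True
    have "(max 0 (1 - (x \<bullet> x) / r\<^sup>2))\<^sup>2 \<le> 1" by (intro power_le_one) auto
    then have "6 / r\<^sup>2 * (max 0 (1 - (x \<bullet> x) / r\<^sup>2))\<^sup>2 * norm x \<le> 6 / r\<^sup>2 * 1 * r"
      using True r by (intro mult_mono) auto
    then show ?thesis using r by (simp add: eq abs_mult power2_eq_square)
  next
    case False
    then have "r\<^sup>2 \<le> x \<bullet> x" using r by (simp flip: power2_norm_eq_inner)
    then show ?thesis using r by (simp add: eq max_def)
  qed
qed

lemma continuous_compact_support_bounded:
  fixes f :: "'a::euclidean_space \<Rightarrow> real"
  assumes "continuous_on UNIV f" and supp: "\<And>x. r \<le> norm x \<Longrightarrow> f x = 0"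
  obtains C where "0 \<le> C" "\<And>x. \<bar>f x\<bar> \<le> C"
proof -
  have "compact (f ` cball 0 r)"
    using assms(1) by (intro compact_continuous_image) (auto intro: continuous_on_subset)
  then obtain C where C: "\<And>y. y \<in> f ` cball 0 r \<Longrightarrow> norm y \<le> C"
    by (meson bounded_iff compact_imp_bounded)
  have "\<bar>f x\<bar> \<le> max 0 C" for x
    by (cases "norm x \<le> r") (use C supp in \<open>auto simp: le_max_iff_disj\<close>)
  then show thesis using that[of "max 0 C"] by simp
qed

lemma frechet_derivative_eq_0_outside:
  fixes f :: "'a::real_normed_vector \<Rightarrow> real"
  assumes "\<And>x. r \<le> norm x \<Longrightarrow> f x = 0" and "r < norm x"
  shows "frechet_derivative f (at x) = (\<lambda>v. 0)"
proof -
  have "open {x::'a. r < norm x}" by (intro open_Collect_less continuous_intros)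
  then have "(f has_derivative (\<lambda>v. 0)) (at x)"
    by (rule has_derivative_transform_within_open[OF has_derivative_const[of 0]])
      (use assms in auto)
  then show ?thesis by (simp add: frechet_derivative_at[symmetric])
qed

lemma DERIV_along_line:
  fixes f :: "'a::real_normed_vector \<Rightarrow> real"
  assumes "f differentiable (at (z + t *\<^sub>R v))"
  shows "((\<lambda>t. f (z + t *\<^sub>R v)) has_real_derivative frechet_derivative f (at (z + t *\<^sub>R v)) v) (at t)"
proof -
  let ?D = "frechet_derivative f (at (z + t *\<^sub>R v))"
  have D: "(f has_derivative ?D) (at (z + t *\<^sub>R v))"
    using assms by (simp add: frechet_derivative_works)
  have "((\<lambda>t. z + t *\<^sub>R v) has_derivative (\<lambda>h. h *\<^sub>R v)) (at t)"
    by (auto intro!: derivative_eq_intros)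
  from has_derivative_compose[OF this D]
  have "((\<lambda>t. f (z + t *\<^sub>R v)) has_derivative (\<lambda>h. ?D (h *\<^sub>R v))) (at t)" .
  also have "(\<lambda>h. ?D (h *\<^sub>R v)) = (*) (?D v)"
    using linear_frechet_derivative[OF assms] by (simp add: fun_eq_iff linear_cmul)
  finally show ?thesis by (simp add: has_field_derivative_def)
qed

text \<open>Second-order Taylor expansion along lines. The second derivatives in pairs of basis directions
are continuous with compact support, hence bounded, and expanding \<open>v\<close> in the basis makes the bound
uniform in the direction. The support of a derivative is controlled on the open complement of
a ball only, whence the radii \<open>r + 1\<close> and \<open>r + 2\<close>.\<close>

lemma Ck2_compact_support_bounds:
  fixes f :: "'a::euclidean_space \<Rightarrow> real"
  assumes f: "Ck 2 f" and supp: "\<And>x. r \<le> norm x \<Longrightarrow> f x = 0"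
  obtains B L M where "0 \<le> M" "\<And>x. \<bar>f x\<bar> \<le> B" "\<And>x. norm (gradient f x) \<le> L"
    "\<And>z v. f (z + v) \<le> f z + gradient f z \<bullet> v + M * (norm v)\<^sup>2"
proof -
  define D where "D b x = frechet_derivative f (at x) b" for b x
  define H where "H b b' x = frechet_derivative (D b) (at x) b'" for b b' x
  have fd: "f differentiable (at x)" for x using f by (simp add: numeral_2_eq_2)
  have Dd: "D b differentiable (at x)" for b x using f by (simp add: numeral_2_eq_2 D_def[abs_def])
  have Hc: "continuous_on UNIV (H b b')" for b b'
    using f by (simp add: numeral_2_eq_2 D_def[abs_def] H_def[abs_def])
  have Dc: "continuous_on UNIV (D b)" for b
    using Dd by (simp add: continuous_on_eq_continuous_within differentiable_imp_continuous_within)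
  have D0: "D b x = 0" if "r + 1 \<le> norm x" for b x
    unfolding D_def using frechet_derivative_eq_0_outside[of r f x] supp that by simp
  have H0: "H b b' x = 0" if "r + 2 \<le> norm x" for b b' x
    unfolding H_def using frechet_derivative_eq_0_outside[of "r + 1" "D b" x] D0 that by simp
  have fc: "continuous_on UNIV f"
    using fd by (simp add: continuous_on_eq_continuous_within differentiable_imp_continuous_within)
  obtain B where B: "\<And>x. \<bar>f x\<bar> \<le> B"
    using continuous_compact_support_bounded[OF fc supp] by metis
  have "\<exists>C. \<forall>x. \<bar>D b x\<bar> \<le> C" for b
    using continuous_compact_support_bounded[OF Dc D0] by metis
  then obtain C where C: "\<And>b x. \<bar>D b x\<bar> \<le> C b" by metis
  have "\<exists>C. 0 \<le> C \<and> (\<forall>x. \<bar>H b b' x\<bar> \<le> C)" for b b'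
    using continuous_compact_support_bounded[OF Hc H0] by metis
  then obtain E where E: "\<And>b b'. 0 \<le> E b b'" "\<And>b b' x. \<bar>H b b' x\<bar> \<le> E b b'" by metis
  define M where "M = (\<Sum>b\<in>(Basis::'a set). \<Sum>b'\<in>(Basis::'a set). E b b')"
  have M: "0 \<le> M" unfolding M_def using E by (intro sum_nonneg) auto
  have grad_b: "gradient f x \<bullet> b = D b x" for x b
    using GDERIV_gradient(2)[OF fd] by (simp add: D_def inner_commute)
  have "norm (gradient f x) \<le> (\<Sum>b\<in>Basis. C b)" for x
    using C unfolding grad_b[symmetric] by (intro order.trans[OF norm_le_l1] sum_mono)
  moreover have "f (z + v) \<le> f z + gradient f z \<bullet> v + M * (norm v)\<^sup>2" for z v
  proof -
    have D_sum: "D v x = (\<Sum>b\<in>Basis. (v \<bullet> b) * D b x)" for x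
      using grad_b[of x v] grad_b[of x] euclidean_inner[of "gradient f x" v] by (simp add: mult.commute)
    have H_sum: "H b v x = (\<Sum>b'\<in>Basis. (v \<bullet> b') * H b b' x)" for b x
    proof -
      have "H b v x = v \<bullet> gradient (D b) x" "\<And>b'. H b b' x = b' \<bullet> gradient (D b) x"
        using GDERIV_gradient(2)[OF Dd] by (auto simp: H_def)
      then show ?thesis using euclidean_inner[of v "gradient (D b) x"] by (simp add: inner_commute)
    qed
    define \<Delta> where "\<Delta> m t = (if m = 0 then f (z + t *\<^sub>R v) else if m = 1 then D v (z + t *\<^sub>R v)
      else (\<Sum>b\<in>Basis. (v \<bullet> b) * H b v (z + t *\<^sub>R v)))" for m :: nat and t
    have "\<exists>t>0. t < 1 \<and> f (z + 1 *\<^sub>R v) = (\<Sum>m<2. \<Delta> m 0 / fact m * 1 ^ m) + \<Delta> 2 t / fact 2 * 1\<^sup>2"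
    proof (rule Maclaurin)
      show "\<forall>m t. m < 2 \<and> 0 \<le> t \<and> t \<le> 1 \<longrightarrow> (\<Delta> m has_real_derivative \<Delta> (Suc m) t) (at t)"
      proof (intro allI impI)
        fix m :: nat and t :: real assume "m < 2 \<and> 0 \<le> t \<and> t \<le> 1"
        then consider "m = 0" | "m = 1" by linarith
        then show "(\<Delta> m has_real_derivative \<Delta> (Suc m) t) (at t)"
        proof cases
          case 1
          then show ?thesis using DERIV_along_line[OF fd] by (simp add: \<Delta>_def[abs_def] D_def)
        next
          case 2
          have "((\<lambda>t. \<Sum>b\<in>Basis. (v \<bullet> b) * D b (z + t *\<^sub>R v)) has_real_derivative
              (\<Sum>b\<in>Basis. (v \<bullet> b) * H b v (z + t *\<^sub>R v))) (at t)"
            unfolding H_def by (intro DERIV_sum DERIV_cmult DERIV_along_line Dd)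
          then show ?thesis using 2 by (simp add: \<Delta>_def[abs_def] D_sum)
        qed
      qed
    qed (auto simp: \<Delta>_def[abs_def])
    then obtain t where t: "f (z + v) = f z + D v z + \<Delta> 2 t / 2"
      by (auto simp: \<Delta>_def numeral_2_eq_2)
    have "\<Delta> 2 t \<le> (\<Sum>b\<in>Basis. \<Sum>b'\<in>Basis. E b b' * (norm v)\<^sup>2)"
      unfolding \<Delta>_def H_sum sum_distrib_left
    proof (simp, intro sum_mono)
      fix b b' :: 'a assume b: "b \<in> Basis" "b' \<in> Basis"
      let ?x = "z + t *\<^sub>R v"
      have "(v \<bullet> b) * ((v \<bullet> b') * H b b' ?x) \<le> \<bar>v \<bullet> b\<bar> * (\<bar>v \<bullet> b'\<bar> * \<bar>H b b' ?x\<bar>)"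
        by (simp flip: abs_mult)
      also have "\<dots> \<le> norm v * (norm v * E b b')"
        using b E Basis_le_norm by (intro mult_mono) auto
      finally show "(v \<bullet> b) * ((v \<bullet> b') * H b b' ?x) \<le> E b b' * (norm v)\<^sup>2"
        by (simp add: power2_eq_square mult_ac)
    qed
    also have "\<dots> = M * (norm v)\<^sup>2" by (simp add: M_def sum_distrib_right)
    finally have "\<Delta> 2 t \<le> M * (norm v)\<^sup>2" .
    moreover have "0 \<le> M * (norm v)\<^sup>2" using M by simp
    ultimately show ?thesis unfolding t using grad_b[of z v] by simp
  qed
  ultimately show thesis using that M B by blast
qed

section \<open>The logarithmic Sobolev inequality\<close>

lemma continuous_on_x_ln_x: "continuous_on {0..} (\<lambda>x::real. x * ln x)"
  unfolding continuous_on_def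
proof
  fix a :: real assume "a \<in> {0..}"
  show "((\<lambda>x. x * ln x) \<longlongrightarrow> a * ln a) (at a within {0..})"
  proof (cases "a = 0")
    case True
    have "((\<lambda>x::real. - (ln (inverse x) / inverse x)) \<longlongrightarrow> - 0) (at_right 0)"
      by (intro tendsto_minus filterlim_compose[OF ln_x_over_x_tendsto_0 filterlim_inverse_at_top_right])
    moreover have "eventually (\<lambda>x::real. - (ln (inverse x) / inverse x) = x * ln x) (at_right 0)"
      by (rule eventually_at_rightI[of 0 1]) (auto simp: ln_inverse divide_inverse)
    ultimately have "((\<lambda>x::real. x * ln x) \<longlongrightarrow> 0) (at_right 0)"
      using tendsto_cong by force
    moreover have "at 0 within {0..} = at_right (0::real)"
    proof -
      have "{0..} - {0} = {0::real<..}" by auto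
      then show ?thesis by (simp add: at_within_def)
    qed
    ultimately show ?thesis using True by simp
  qed (auto intro!: tendsto_intros)
qed

text \<open>This supplies an integrable majorant for the entropy integrands of the approximations \<open>f k\<close> below,
which satisfy \<open>0 < f k x \<le> (g x)\<^sup>2 + 1\<close>.\<close>

lemma abs_x_ln_x_dominated:
  fixes a y :: real
  assumes "0 < y" "y \<le> a + 1" "0 \<le> a"
  shows "\<bar>y * ln y\<bar> \<le> 2 * \<bar>a * ln a\<bar> + 2 * a + 2"
proof (cases "y \<le> 1")
  case True
  have "ln (inverse y) \<le> inverse y - 1" using assms by (intro ln_le_minus_one) auto
  then have "y * - ln y \<le> y * (inverse y - 1)"
    using assms by (intro mult_left_mono) (auto simp: ln_inverse)
  also have "\<dots> \<le> 1" using assms by (simp add: algebra_simps)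
  finally have "- (y * ln y) \<le> 1" by simp
  moreover have "y * ln y \<le> 0" using True assms by (simp add: mult_nonneg_nonpos)
  ultimately show ?thesis using assms by simp
next
  case False
  have "ln 2 \<le> (1::real)" using ln_le_minus_one[of 2] by simp
  have le: "\<bar>y * ln y\<bar> \<le> b * ln b" if "y \<le> b" for b
    using that False by (auto simp: abs_mult intro!: mult_mono)
  show ?thesis
  proof (cases "a \<le> 1")
    case True
    have "\<bar>y * ln y\<bar> \<le> 2 * ln 2" using True assms by (intro le) auto
    then show ?thesis using \<open>ln 2 \<le> 1\<close> assms by linarith
  next
    case False
    have "\<bar>y * ln y\<bar> \<le> (2 * a) * ln (2 * a)" using False assms by (intro le) auto
    also have "\<dots> = 2 * a * ln 2 + 2 * (a * ln a)" using False by (simp add: ln_mult algebra_simps)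
    also have "\<dots> \<le> 2 * a * 1 + 2 * \<bar>a * ln a\<bar>"
      using False \<open>ln 2 \<le> 1\<close> by (intro add_mono mult_left_mono) auto
    finally show ?thesis by simp
  qed
qed

lemma continuous_on_gradient:
  fixes f :: "'a::euclidean_space \<Rightarrow> real"
  assumes "Ck 1 f"
  shows "continuous_on UNIV (gradient f)"
proof -
  have d: "f differentiable (at x)" and c: "continuous_on UNIV (\<lambda>x. frechet_derivative f (at x) b)" for x b
    using assms by auto
  have "frechet_derivative f (at x) b = gradient f x \<bullet> b" for x b
    using GDERIV_gradient(2)[OF d] by (simp add: inner_commute)
  then have "gradient f = (\<lambda>x. \<Sum>b\<in>Basis. frechet_derivative f (at x) b *\<^sub>R b)"
    by (simp add: euclidean_representation)
  then show ?thesis by (auto intro!: continuous_intros c)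
qed

text \<open>The function \<open>(g * cutoff r)\<^sup>2\<close> has bounded derivatives up to order 2, and adding \<open>\<epsilon>\<close> keeps it away from zero, so the
entropy bound for semiconcave functions applies. Since \<open>|grad (h\<^sup>2)|\<^sup>2 = 4 h\<^sup>2 |grad h|\<^sup>2\<close>, dividing by
\<open>h\<^sup>2 + \<epsilon>\<close> leaves at most \<open>4 |grad h|\<^sup>2\<close>, which has no \<open>\<epsilon>\<close> in it.\<close>

lemma Ent_cutoff_le:
  fixes p g :: "'a::euclidean_space \<Rightarrow> real"
  assumes p[measurable]: "p \<in> borel_measurable borel" and p0: "\<And>x. 0 \<le> p x"
    and prob: "prob_space (density lborel (\<lambda>x. ennreal (p x)))"
    and slc: "strongly_log_concave c p" and c: "0 < c"
    and g: "Ck 2 g" and r: "0 < r" and \<epsilon>: "0 < \<epsilon>"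
  defines "\<nu> \<equiv> density lborel (\<lambda>x. ennreal (p x))"
  assumes g2: "integrable \<nu> (\<lambda>x. (g x)\<^sup>2)" and dg2: "integrable \<nu> (\<lambda>x. (norm (gradient g x))\<^sup>2)"
  shows "Ent \<nu> (\<lambda>x. (g x * cutoff r x)\<^sup>2 + \<epsilon>) \<le>
    2 / c * (8 * (\<integral>x. (norm (gradient g x))\<^sup>2 \<partial>\<nu>) + 8 * (6 / r)\<^sup>2 * (\<integral>x. (g x)\<^sup>2 \<partial>\<nu>))"
proof -
  define h where "h x = g x * cutoff r x" for x
  define \<psi> where "\<psi> x = h x * h x" for x
  have h2: "Ck 2 h" unfolding h_def by (intro Ck_mult g Ck_cutoff)
  then have \<psi>2: "Ck 2 \<psi>" unfolding \<psi>_def by (intro Ck_mult)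
  then have \<psi>1: "Ck 1 \<psi>" using Ck_Suc_imp_Ck[of 1 \<psi>] by (simp only: numeral_2_eq_2 One_nat_def)
  have gd: "g differentiable (at x)" for x using g by (simp add: numeral_2_eq_2)
  have cd: "GDERIV (cutoff r) x :> gradient (cutoff r) x" for x
    using GDERIV_cutoff gradient_eqI by metis
  have hd: "GDERIV h x :> g x *\<^sub>R gradient (cutoff r) x + cutoff r x *\<^sub>R gradient g x" for x
    unfolding h_def by (intro GDERIV_mult GDERIV_gradient(1) gd cd)
  define dh where "dh x = g x *\<^sub>R gradient (cutoff r) x + cutoff r x *\<^sub>R gradient g x" for x
  have "GDERIV \<psi> x :> h x *\<^sub>R dh x + h x *\<^sub>R dh x" for x
    unfolding \<psi>_def dh_def by (intro GDERIV_mult hd)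
  then have \<psi>_grad: "gradient \<psi> x = (2 * h x) *\<^sub>R dh x" for x
    by (subst gradient_eqI) (auto simp: scaleR_2 simp flip: scaleR_scaleR)
  have \<psi>0: "0 \<le> \<psi> x" for x by (simp add: \<psi>_def)
  have supp: "\<psi> x = 0" if "r \<le> norm x" for x
    using cutoff_eq_0[OF r that] by (simp add: \<psi>_def h_def)
  obtain B L M where bds: "0 \<le> M" "\<And>x. \<bar>\<psi> x\<bar> \<le> B" "\<And>x. norm (gradient \<psi> x) \<le> L"
    "\<And>z v. \<psi> (z + v) \<le> \<psi> z + gradient \<psi> z \<bullet> v + M * (norm v)\<^sup>2"
    using Ck2_compact_support_bounds[OF \<psi>2 supp] by metis
  have \<psi>c: "continuous_on UNIV \<psi>" using Ck_Suc_imp_Ck[of 0 \<psi>] \<psi>1 by simp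
  have [measurable]: "\<psi> \<in> borel_measurable borel" "gradient \<psi> \<in> borel_measurable borel"
    using \<psi>c continuous_on_gradient[OF \<psi>1] by (auto intro: borel_measurable_continuous_onI)
  have "Ent \<nu> (\<lambda>x. \<psi> x + \<epsilon>) \<le> 2 / c * (\<integral>x. (norm (gradient \<psi> x))\<^sup>2 / (\<psi> x + \<epsilon>) \<partial>\<nu>)"
    unfolding \<nu>_def
    by (rule entropy_le_energy_of_semiconcave[OF p p0 prob slc c, where \<epsilon> = \<epsilon> and B = "B + \<epsilon>" and L = L and M = M])
      (use bds \<epsilon> \<psi>0 in \<open>auto simp: abs_le_iff algebra_simps\<close>)
  also have "\<dots> \<le> 2 / c * (\<integral>x. 8 * (norm (gradient g x))\<^sup>2 + 8 * (6 / r)\<^sup>2 * (g x)\<^sup>2 \<partial>\<nu>)"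
  proof (intro mult_left_mono integral_mono')
    fix x
    have "norm (dh x) \<le> \<bar>g x\<bar> * norm (gradient (cutoff r) x) + \<bar>cutoff r x\<bar> * norm (gradient g x)"
      unfolding dh_def using norm_triangle_ineq by (metis norm_scaleR)
    also have "\<dots> \<le> \<bar>g x\<bar> * (6 / r) + 1 * norm (gradient g x)"
      using norm_gradient_cutoff[OF r, of x] cutoff_bounds[of r x] by (intro add_mono mult_mono) auto
    finally have "(norm (dh x))\<^sup>2 \<le> (\<bar>g x\<bar> * (6 / r) + norm (gradient g x))\<^sup>2"
      by (intro power_mono) auto
    also have "\<dots> \<le> 2 * (\<bar>g x\<bar> * (6 / r))\<^sup>2 + 2 * (norm (gradient g x))\<^sup>2"
      unfolding power2_sum using sum_squares_bound[of "\<bar>g x\<bar> * (6 / r)" "norm (gradient g x)"] by linarith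
    also have "(\<bar>g x\<bar> * (6 / r))\<^sup>2 = (6 / r)\<^sup>2 * (g x)\<^sup>2"
      unfolding power_mult_distrib power2_abs by (rule mult.commute)
    finally have dh: "(norm (dh x))\<^sup>2 \<le> 2 * ((6 / r)\<^sup>2 * (g x)\<^sup>2) + 2 * (norm (gradient g x))\<^sup>2" .
    have "(norm (gradient \<psi> x))\<^sup>2 = 4 * \<psi> x * (norm (dh x))\<^sup>2"
      unfolding \<psi>_grad by (simp add: \<psi>_def power2_eq_square abs_mult)
    also have "\<dots> \<le> 4 * (norm (dh x))\<^sup>2 * (\<psi> x + \<epsilon>)"
      using \<epsilon> by (simp add: algebra_simps)
    finally have "(norm (gradient \<psi> x))\<^sup>2 / (\<psi> x + \<epsilon>) \<le> 4 * (norm (dh x))\<^sup>2"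
      using \<epsilon> \<psi>0[of x] by (simp add: pos_divide_le_eq add_nonneg_pos)
    with dh show "(norm (gradient \<psi> x))\<^sup>2 / (\<psi> x + \<epsilon>) \<le> 8 * (norm (gradient g x))\<^sup>2 + 8 * (6 / r)\<^sup>2 * (g x)\<^sup>2"
      by linarith
  qed (use g2 dg2 c in auto)
  also have "(\<integral>x. 8 * (norm (gradient g x))\<^sup>2 + 8 * (6 / r)\<^sup>2 * (g x)\<^sup>2 \<partial>\<nu>) =
      8 * (\<integral>x. (norm (gradient g x))\<^sup>2 \<partial>\<nu>) + 8 * (6 / r)\<^sup>2 * (\<integral>x. (g x)\<^sup>2 \<partial>\<nu>)"
    using g2 dg2 by simp
  finally show ?thesis by (simp add: \<psi>_def h_def power2_eq_square)
qed

text \<open>A constant of Bakry--Emery type. The inequality of the previous lemma is used for cutoffs at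
radius \<open>k + 1\<close> and \<open>\<epsilon> = 1 / (k + 1)\<close>, and \<open>k\<close> tends to infinity: the gradient of the cutoff is \<open>O(1 / k)\<close>,
so its contribution vanishes because \<open>g\<^sup>2\<close> is integrable, and the three integrability hypotheses
on \<open>g\<close> give dominated convergence of the entropies. The factor \<open>8 / c\<close> instead of the sharp \<open>1 / c\<close> comes from
the crude estimates made on the way.\<close>

theorem log_sobolev_of_strongly_log_concave:
  fixes p :: "'a::euclidean_space \<Rightarrow> real"
  assumes p: "p \<in> borel_measurable borel" and p0: "\<And>x. 0 \<le> p x"
    and prob: "prob_space (density lborel (\<lambda>x. ennreal (p x)))"
    and slc: "strongly_log_concave c p" and c: "0 < c"
  shows "log_sobolev (density lborel (\<lambda>x. ennreal (p x))) (8 / c)"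
  unfolding log_sobolev_def
proof (intro allI impI)
  fix g :: "'a \<Rightarrow> real"
  define \<nu> where "\<nu> = density lborel (\<lambda>x. ennreal (p x))"
  assume "smooth g" and g2: "integrable (density lborel (\<lambda>x. ennreal (p x))) (\<lambda>x. (g x)\<^sup>2)"
    and gl: "integrable (density lborel (\<lambda>x. ennreal (p x))) (\<lambda>x. (g x)\<^sup>2 * ln ((g x)\<^sup>2))"
    and dg2: "integrable (density lborel (\<lambda>x. ennreal (p x))) (\<lambda>x. (norm (gradient g x))\<^sup>2)"
  note int = g2[folded \<nu>_def] gl[folded \<nu>_def] dg2[folded \<nu>_def]
  interpret \<nu>: prob_space \<nu> unfolding \<nu>_def by (rule prob)
  have sets[measurable_cong]: "sets \<nu> = sets borel" by (simp add: \<nu>_def)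
  have gk: "Ck k g" for k using \<open>smooth g\<close> by (simp add: smooth_def)
  have [measurable]: "g \<in> borel_measurable borel"
    using gk[of 0] by (auto intro: borel_measurable_continuous_onI)
  define f where "f k x = (g x * cutoff (real (Suc k)) x)\<^sup>2 + inverse (real (Suc k))" for k x
  have [measurable]: "f k \<in> borel_measurable borel" for k
  proof -
    have "Ck 0 (cutoff (real (Suc k)) :: 'a \<Rightarrow> real)"
      using Ck_cutoff Ck_Suc_imp_Ck by (metis numeral_2_eq_2)
    then have [measurable]: "(cutoff (real (Suc k)) :: 'a \<Rightarrow> real) \<in> borel_measurable borel"
      by (auto intro: borel_measurable_continuous_onI)
    show ?thesis unfolding f_def by measurable
  qed
  have f_pos: "0 < f k x" for k x unfolding f_def by (intro add_nonneg_pos) auto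
  have f_le: "f k x \<le> (g x)\<^sup>2 + 1" for k x
  proof -
    have "(g x)\<^sup>2 * (cutoff (real (Suc k)) x)\<^sup>2 \<le> (g x)\<^sup>2 * 1"
      using cutoff_bounds[of "real (Suc k)" x] by (intro mult_left_mono power_le_one) auto
    moreover have "inverse (real (Suc k)) \<le> 1" by (simp add: inverse_le_1_iff)
    ultimately show ?thesis by (simp add: f_def power_mult_distrib)
  qed
  have inv0: "(\<lambda>k. inverse (real (Suc k))) \<longlonglongrightarrow> 0" by (rule LIMSEQ_inverse_real_of_nat)
  have f_lim: "(\<lambda>k. f k x) \<longlonglongrightarrow> (g x)\<^sup>2" for x
  proof -
    have "(\<lambda>k. f k x) \<longlonglongrightarrow> (g x * 1)\<^sup>2 + 0"
      unfolding f_def by (intro tendsto_intros cutoff_tendsto_1 inv0)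
    then show ?thesis by simp
  qed
  have xlnx: "(\<lambda>k. a k * ln (a k)) \<longlonglongrightarrow> b * ln b" if "a \<longlonglongrightarrow> b" "\<And>k. 0 \<le> a k" "0 \<le> b" for a :: "nat \<Rightarrow> real" and b
    by (rule continuous_on_tendsto_compose[OF continuous_on_x_ln_x that(1)]) (use that in auto)
  have I1: "(\<lambda>k. \<integral>x. f k x \<partial>\<nu>) \<longlonglongrightarrow> (\<integral>x. (g x)\<^sup>2 \<partial>\<nu>)"
    by (rule integral_dominated_convergence[where w = "\<lambda>x. (g x)\<^sup>2 + 1"])
      (use int f_lim f_le f_pos in \<open>auto simp: less_imp_le\<close>)
  have I2: "(\<lambda>k. \<integral>x. f k x * ln (f k x) \<partial>\<nu>) \<longlonglongrightarrow> (\<integral>x. (g x)\<^sup>2 * ln ((g x)\<^sup>2) \<partial>\<nu>)"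
  proof (rule integral_dominated_convergence[where w = "\<lambda>x. 2 * \<bar>(g x)\<^sup>2 * ln ((g x)\<^sup>2)\<bar> + 2 * (g x)\<^sup>2 + 2"])
    show "AE x in \<nu>. (\<lambda>k. f k x * ln (f k x)) \<longlonglongrightarrow> (g x)\<^sup>2 * ln ((g x)\<^sup>2)"
      by (intro AE_I2 xlnx f_lim) (auto simp: f_pos less_imp_le)
    show "AE x in \<nu>. norm (f k x * ln (f k x)) \<le> 2 * \<bar>(g x)\<^sup>2 * ln ((g x)\<^sup>2)\<bar> + 2 * (g x)\<^sup>2 + 2" for k
      unfolding real_norm_def by (intro AE_I2 abs_x_ln_x_dominated f_pos f_le) simp
    show "integrable \<nu> (\<lambda>x. 2 * \<bar>(g x)\<^sup>2 * ln ((g x)\<^sup>2)\<bar> + 2 * (g x)\<^sup>2 + 2)"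
      using int by (intro Bochner_Integration.integrable_add integrable_mult_right integrable_abs \<nu>.integrable_const)
  qed measurable
  have "(\<lambda>k. (\<integral>x. f k x \<partial>\<nu>) * ln (\<integral>x. f k x \<partial>\<nu>)) \<longlonglongrightarrow> (\<integral>x. (g x)\<^sup>2 \<partial>\<nu>) * ln (\<integral>x. (g x)\<^sup>2 \<partial>\<nu>)"
    using f_pos by (intro xlnx I1 Bochner_Integration.integral_nonneg) (auto simp: less_imp_le)
  with I2 have L1: "(\<lambda>k. Ent \<nu> (f k)) \<longlonglongrightarrow> Ent \<nu> (\<lambda>x. (g x)\<^sup>2)"
    unfolding Ent_def by (rule tendsto_diff)
  have L2: "(\<lambda>k. 2 / c * (8 * (\<integral>x. (norm (gradient g x))\<^sup>2 \<partial>\<nu>) +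
        8 * (6 * inverse (real (Suc k)))\<^sup>2 * (\<integral>x. (g x)\<^sup>2 \<partial>\<nu>)))
      \<longlonglongrightarrow> 2 / c * (8 * (\<integral>x. (norm (gradient g x))\<^sup>2 \<partial>\<nu>) + 8 * (6 * 0)\<^sup>2 * (\<integral>x. (g x)\<^sup>2 \<partial>\<nu>))"
    by (intro tendsto_intros inv0)
  have L3: "Ent \<nu> (f k) \<le> 2 / c * (8 * (\<integral>x. (norm (gradient g x))\<^sup>2 \<partial>\<nu>) +
        8 * (6 * inverse (real (Suc k)))\<^sup>2 * (\<integral>x. (g x)\<^sup>2 \<partial>\<nu>))" for k
    using Ent_cutoff_le[OF p p0 prob slc c gk, of "real (Suc k)" "inverse (real (Suc k))"] g2 dg2
    unfolding f_def[abs_def] \<nu>_def by (simp only: divide_inverse) simp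
  have "Ent \<nu> (\<lambda>x. (g x)\<^sup>2) \<le>
      2 / c * (8 * (\<integral>x. (norm (gradient g x))\<^sup>2 \<partial>\<nu>) + 8 * (6 * 0)\<^sup>2 * (\<integral>x. (g x)\<^sup>2 \<partial>\<nu>))"
    using LIMSEQ_le[OF L1 L2] L3 by blast
  then show "Ent (density lborel (\<lambda>x. ennreal (p x))) (\<lambda>x. (g x)\<^sup>2) \<le>
      2 * (8 / c) * (\<integral>x. (norm (gradient g x))\<^sup>2 \<partial>density lborel (\<lambda>x. ennreal (p x)))"
    unfolding \<nu>_def by (simp add: mult_ac)
qed

theorem theorem18:
  fixes \<mu> :: "(real ^ 'n) measure" and R \<delta> :: real
  assumes "prob_space \<mu>" and "sets \<mu> = sets borel"
    and "\<exists>a. measure_support \<mu> \<subseteq> cball a R"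
    and "\<delta> > 0" and "\<delta> > 2 * R\<^sup>2 * real CARD('n)"
  shows "\<exists>c::real. log_sobolev (convolution \<mu> (gaussian_measure \<delta>)) c"
proof -
  obtain a where a: "measure_support \<mu> \<subseteq> cball a R" using assms(3) by blast
  have supp: "AE \<xi> in \<mu>. norm (\<xi> - a) \<le> R"
    using AE_measure_support[OF assms(2)]
    by eventually_elim (use a in \<open>auto simp: dist_norm norm_minus_commute\<close>)
  define K where "K = (2 * pi * \<delta>) powr (- (real CARD('n) / 2))"
  define p where "p z = (\<integral>\<xi>. K * exp (- (norm (z - \<xi>))\<^sup>2 / (2 * \<delta>)) \<partial>\<mu>)" for z
  define c where "c = 1 / \<delta> - R\<^sup>2 / \<delta>\<^sup>2"
  have K: "0 < K" using assms(4) by (simp add: K_def)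
  have slc: "strongly_log_concave c p"
    unfolding c_def p_def
    by (rule strongly_log_concave_gaussian_mixture[OF assms(1,2) supp assms(4) K])
  have "1 \<le> real CARD('n)" by (simp add: Suc_le_eq)
  then have "1 \<le> 2 * real CARD('n)" by linarith
  from mult_left_mono[OF this, of "R\<^sup>2"]
  have "R\<^sup>2 \<le> R\<^sup>2 * (2 * real CARD('n))" by simp
  then have "R\<^sup>2 < \<delta>" using assms(5) by (simp add: mult_ac)
  then have c: "0 < c" using assms(4) by (simp add: c_def field_simps power2_eq_square)
  note conv = convolution_gaussian_eq_density[OF assms(1,2,4), folded K_def, folded p_def]
  have "log_sobolev (density lborel (\<lambda>z. ennreal (p z))) (8 / c)"
  proof (rule log_sobolev_of_strongly_log_concave[OF _ _ _ slc c])
    show "0 \<le> p z" for z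
      unfolding p_def using K by (intro Bochner_Integration.integral_nonneg) simp
  qed (use conv in \<open>auto simp flip: p_def\<close>)
  then show ?thesis using conv(2) by (auto simp flip: p_def)
qed

end
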